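(* Let $K$ be a number field, $P_K$ the set of maximal ideals of $O_K$, and $DR_K = \hat{O}_K \times_{\hat{O}_K^\times} G_K^{ab}$ its Deligne-Ribet monoid. For a subset $S \subseteq P_K$ let $e_S := [1_S, 1] \in DR_K$, which is an idempotent. Then every idempotent $e \in DR_K$ is equal to $e_{S_e}$ for some unique subset $S_e \subseteq P_K$, which is given explicitly as follows: writing $e = [\rho_e, s_e]$ with $\rho_e \in \hat{O}_K$ and $s_e \in G_K^{ab}$, $$S_e = \{ \mathfrak{p} \in P_K \mid v_{\mathfrak{p}}(\rho_{e,\mathfrak{p}}) = 0 \}.$$
   Context: For a number field $K$ with ring of integers $O_K$: $P_K$ is the set of maximal ideals of $O_K$; $O_{\mathfrak{p}}$ is the completion of $O_K$ at $\mathfrak{p}$, with normalized valuation $v_{\mathfrak{p}}$ (and $v_{\mathfrak{p}}(0)=\infty$); $\hat{O}_K = \prod_{\mathfrak{p} \in P_K} O_{\mathfrak{p}}$ is the profinite completion of $O_K$, and $\rho_{\mathfrak{p}}$ is the $\mathfrak{p}$-component of $\rho \in \hat{O}_K$; $G_K^{ab}$ is the Galois group of the maximal abelian extension of $K$; $\mathrm{rec}: \mathbb{A}_{K,f}^\times \to G_K^{ab}$ is the restriction of the global Artin reciprocity map to finite ideles (extended by $1$ at the archimedean places). The Deligne-Ribet monoid of $K$ is the profinite (commutative topological) monoid $$DR_K = \hat{O}_K \times_{\hat{O}_K^\times} G_K^{ab},$$ the quotient of the multiplicative monoid $\hat{O}_K \times G_K^{ab}$ by the relation $(\rho, s) \sim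 (\rho u, \mathrm{rec}(u)^{-1} s)$ for $u \in \hat{O}_K^\times$, with componentwise multiplication and the quotient topology. The class of $(\rho,s)$ is denoted $[\rho,s]$. For $S \subseteq P_K$, $1_S \in \hat{O}_K$ is the element with $(1_S)_{\mathfrak{p}} = 1$ if $\mathfrak{p} \in S$ and $(1_S)_{\mathfrak{p}} = 0$ otherwise. *)

theory Defs
  imports
    "HOL-Algebra.Algebra"
    "HOL-Algebra.Algebraic_Closure_Type"
    "HOL-Analysis.Analysis"
    "HOL-Library.Extended_Nat"
begin

section \<open>Number fields, rings of integers and their completions\<close>

text \<open>A number field is a type of class \<open>number_field\<close>; an algebraic closure of it is the type
  \<^typ>\<open>'k alg_closure\<close>, into which it is embedded by \<^const>\<open>to_ac\<close>.\<close>

class number_field = field_char_0 +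
  assumes finite_dimension_over_Rats:
    "ring.finite_dimension (ring_of_type_algebra :: 'a ring) \<rat> UNIV"

definition integer_ring :: "'a::field set \<Rightarrow> 'a ring" where
  "integer_ring L = ring_of_type_algebra \<lparr>carrier := {x \<in> L. algebraic_int x}\<rparr>"

definition finite_places :: "'a::field set \<Rightarrow> 'a set set" where
  "finite_places L = {P. maximalideal P (integer_ring L)}"

abbreviation O\<^sub>K :: "'k::number_field ring" where
  "O\<^sub>K \<equiv> integer_ring UNIV"

abbreviation P\<^sub>K :: "'k::number_field set set" where
  "P\<^sub>K \<equiv> finite_places UNIV"

definition ideal_power :: "('a, 'b) ring_scheme \<Rightarrow> 'a set \<Rightarrow> nat \<Rightarrow> 'a set" where
  "ideal_power R I n = I [^]\<^bsub>ideals_set R\<^esub> n"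

type_synonym 'k local_integer = "nat \<Rightarrow> 'k set"

abbreviation residue_ring_pow :: "'k::number_field set \<Rightarrow> nat \<Rightarrow> 'k set ring" where
  "residue_ring_pow \<pp> n \<equiv> O\<^sub>K Quot (ideal_power O\<^sub>K \<pp> n)"

text \<open>The completion of the ring of integers at \<open>\<pp>\<close> is the inverse limit of its quotients by the
  powers of \<open>\<pp>\<close>.  The elements of these quotients are cosets, and the transition maps send a coset of
  the power \<open>n + 1\<close> to the coset of the power \<open>n\<close> containing it.\<close>

definition completion :: "'k::number_field set \<Rightarrow> 'k local_integer ring" where
  "completion \<pp> =
    \<lparr>carrier = {x. \<forall>n. x n \<in> carrier (residue_ring_pow \<pp> n) \<and> x (Suc n) \<subseteq> x n},
     monoid.mult = (\<lambda>x y n. x n \<otimes>\<^bsub>residue_ring_pow \<pp> n\<^esub> y n),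
     monoid.one = (\<lambda>n. \<one>\<^bsub>residue_ring_pow \<pp> n\<^esub>),
     ring.zero = (\<lambda>n. \<zero>\<^bsub>residue_ring_pow \<pp> n\<^esub>),
     ring.add = (\<lambda>x y n. x n \<oplus>\<^bsub>residue_ring_pow \<pp> n\<^esub> y n)\<rparr>"

definition to_completion :: "'k::number_field set \<Rightarrow> 'k \<Rightarrow> 'k local_integer" where
  "to_completion \<pp> a = (\<lambda>n. ideal_power O\<^sub>K \<pp> n +>\<^bsub>O\<^sub>K\<^esub> a)"

text \<open>The normalized valuation of \<open>x\<close> is the largest \<open>n\<close> such that \<open>x\<close> lies in the \<open>n\<close>-th power of
  the maximal ideal of the completion, that is, such that \<open>x\<close> vanishes modulo the \<open>n\<close>-th power
  of \<open>\<pp>\<close>; it is \<open>\<infinity>\<close> for \<open>x = 0\<close>.\<close>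

definition valuation :: "'k::number_field set \<Rightarrow> 'k local_integer \<Rightarrow> enat" where
  "valuation \<pp> x = (SUP n \<in> {n. x n = \<zero>\<^bsub>residue_ring_pow \<pp> n\<^esub>}. enat n)"

text \<open>The multiplicative monoid of the product of all completions.\<close>

definition profinite_integers :: "('k::number_field set \<Rightarrow> 'k local_integer) monoid" where
  "profinite_integers = product_group P\<^sub>K completion"

definition indicator_integer ::
    "'k::number_field set set \<Rightarrow> 'k set \<Rightarrow> 'k local_integer" where
  "indicator_integer S =
    (\<lambda>\<pp>\<in>P\<^sub>K. if \<pp> \<in> S then \<one>\<^bsub>completion \<pp>\<^esub> else \<zero>\<^bsub>completion \<pp>\<^esub>)"

section \<open>Ideles\<close>

text \<open>The total ring of fractions, which for a domain is the field of fractions since there the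
  regular elements are the nonzero ones.\<close>

definition regular_elements :: "('a, 'b) ring_scheme \<Rightarrow> 'a set" where
  "regular_elements R =
    {b \<in> carrier R. \<forall>a \<in> carrier R. a \<otimes>\<^bsub>R\<^esub> b = \<zero>\<^bsub>R\<^esub> \<longrightarrow> a = \<zero>\<^bsub>R\<^esub>}"

definition fraction_rel :: "('a, 'b) ring_scheme \<Rightarrow> (('a \<times> 'a) \<times> ('a \<times> 'a)) set" where
  "fraction_rel R = {((a, b), (c, d)).
    a \<in> carrier R \<and> b \<in> regular_elements R \<and> c \<in> carrier R \<and> d \<in> regular_elements R \<and>
    a \<otimes>\<^bsub>R\<^esub> d = c \<otimes>\<^bsub>R\<^esub> b}"

definition fraction :: "('a, 'b) ring_scheme \<Rightarrow> 'a \<Rightarrow> 'a \<Rightarrow> ('a \<times> 'a) set" where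
  "fraction R a b = fraction_rel R `` {(a, b)}"

definition fraction_ring :: "('a, 'b) ring_scheme \<Rightarrow> ('a \<times> 'a) set ring" where
  "fraction_ring R =
    \<lparr>carrier = (carrier R \<times> regular_elements R) // fraction_rel R,
     monoid.mult = (\<lambda>A B. \<Union>x\<in>A. \<Union>y\<in>B. fraction R (fst x \<otimes>\<^bsub>R\<^esub> fst y) (snd x \<otimes>\<^bsub>R\<^esub> snd y)),
     monoid.one = fraction R \<one>\<^bsub>R\<^esub> \<one>\<^bsub>R\<^esub>,
     ring.zero = fraction R \<zero>\<^bsub>R\<^esub> \<one>\<^bsub>R\<^esub>,
     ring.add = (\<lambda>A B. \<Union>x\<in>A. \<Union>y\<in>B.
       fraction R ((fst x \<otimes>\<^bsub>R\<^esub> snd y) \<oplus>\<^bsub>R\<^esub> (fst y \<otimes>\<^bsub>R\<^esub> snd x)) (snd x \<otimes>\<^bsub>R\<^esub> snd y))\<rparr>"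

type_synonym 'k local_number = "('k local_integer \<times> 'k local_integer) set"

definition local_field :: "'k::number_field set \<Rightarrow> 'k local_number ring" where
  "local_field \<pp> = fraction_ring (completion \<pp>)"

definition to_local_field :: "'k::number_field set \<Rightarrow> 'k local_integer \<Rightarrow> 'k local_number" where
  "to_local_field \<pp> x = fraction (completion \<pp>) x \<one>\<^bsub>completion \<pp>\<^esub>"

type_synonym 'k finite_idele = "'k set \<Rightarrow> 'k local_number"

definition finite_ideles :: "'k::number_field finite_idele monoid" where
  "finite_ideles = (product_group P\<^sub>K (\<lambda>\<pp>. units_of (local_field \<pp>)))
    \<lparr>carrier := {x \<in> (\<Pi>\<^sub>E \<pp>\<in>P\<^sub>K. Units (local_field \<pp>)).
       finite {\<pp> \<in> P\<^sub>K. x \<pp> \<notin> to_local_field \<pp> ` Units (completion \<pp>)}}\<rparr>"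

definition unit_idele ::
    "('k::number_field set \<Rightarrow> 'k local_integer) \<Rightarrow> 'k finite_idele" where
  "unit_idele u = (\<lambda>\<pp>\<in>P\<^sub>K. to_local_field \<pp> (u \<pp>))"

definition congruence_unit_ideles ::
    "('k::number_field set \<Rightarrow> nat) \<Rightarrow> 'k finite_idele set" where
  "congruence_unit_ideles m = unit_idele `
    {u \<in> Units profinite_integers. \<forall>\<pp>\<in>P\<^sub>K. u \<pp> (m \<pp>) = \<one>\<^bsub>completion \<pp>\<^esub> (m \<pp>)}"

definition finite_idele_topology :: "'k::number_field finite_idele topology" where
  "finite_idele_topology = topology_generated_by
    {x <#\<^bsub>finite_ideles\<^esub> congruence_unit_ideles m | x m.
      x \<in> carrier finite_ideles \<and> finite {\<pp> \<in> P\<^sub>K. m \<pp> \<noteq> 0}}"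

text \<open>The archimedean ideles are the units of the product of the archimedean completions of \<open>K\<close>.
  This product is realized as the Minkowski space: the families of complex numbers indexed by the
  complex embeddings of \<open>K\<close> that are compatible with complex conjugation.\<close>

definition complex_embeddings :: "('k::number_field \<Rightarrow> complex) set" where
  "complex_embeddings = ring_hom ring_of_type_algebra ring_of_type_algebra"

type_synonym 'k archimedean_idele = "('k \<Rightarrow> complex) \<Rightarrow> complex"

definition archimedean_ideles :: "'k::number_field archimedean_idele monoid" where
  "archimedean_ideles =
    (product_group complex_embeddings (\<lambda>_. units_of ring_of_type_algebra))
    \<lparr>carrier := {z \<in> (\<Pi>\<^sub>E \<sigma>\<in>complex_embeddings. UNIV - {0}).
       \<forall>\<sigma>\<in>complex_embeddings. z (cnj \<circ> \<sigma>) = cnj (z \<sigma>)}\<rparr>"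

definition archimedean_idele_topology :: "'k::number_field archimedean_idele topology" where
  "archimedean_idele_topology = subtopology
    (product_topology (\<lambda>_. euclidean) complex_embeddings) (carrier archimedean_ideles)"

type_synonym 'k idele = "'k finite_idele \<times> 'k archimedean_idele"

definition ideles :: "'k::number_field idele monoid" where
  "ideles = finite_ideles \<times>\<times> archimedean_ideles"

definition idele_topology :: "'k::number_field idele topology" where
  "idele_topology = prod_topology finite_idele_topology archimedean_idele_topology"

text \<open>The principal idele of \<open>a / b\<close>, for nonzero integers \<open>a\<close> and \<open>b\<close> of the number field; every
  nonzero element of the number field is such a quotient.\<close>

definition principal_idele :: "'k::number_field \<Rightarrow> 'k \<Rightarrow> 'k idele" where
  "principal_idele a b =
    (\<lambda>\<pp>\<in>P\<^sub>K. fraction (completion \<pp>) (to_completion \<pp> a) (to_completion \<pp> b),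
     \<lambda>\<sigma>\<in>complex_embeddings. \<sigma> (a / b))"

definition local_idele :: "'k::number_field set \<Rightarrow> 'k local_integer \<Rightarrow> 'k idele" where
  "local_idele \<pp> \<pi> =
    (\<lambda>\<qq>\<in>P\<^sub>K. if \<qq> = \<pp> then to_local_field \<pp> \<pi> else \<one>\<^bsub>local_field \<qq>\<^esub>,
     \<one>\<^bsub>archimedean_ideles\<^esub>)"

section \<open>Abelian extensions\<close>

definition galois_group :: "'k::field alg_closure set \<Rightarrow> ('k alg_closure \<Rightarrow> 'k alg_closure) monoid"
  where
  "galois_group L = BijGroup L
    \<lparr>carrier := {\<sigma> \<in> Bij L.
       \<sigma> \<in> ring_hom (ring_of_type_algebra \<lparr>carrier := L\<rparr>) (ring_of_type_algebra \<lparr>carrier := L\<rparr>) \<and>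
       (\<forall>x. \<sigma> (to_ac x) = to_ac x)}\<rparr>"

definition finite_abelian_extension :: "'k::field alg_closure set \<Rightarrow> bool" where
  "finite_abelian_extension L \<longleftrightarrow>
    subfield L ring_of_type_algebra \<and> range to_ac \<subseteq> L \<and>
    ring.finite_dimension ring_of_type_algebra (range to_ac) L \<and>
    {x \<in> L. \<forall>\<sigma> \<in> carrier (galois_group L). \<sigma> x = x} = range to_ac \<and>
    comm_group (galois_group L)"

text \<open>The maximal abelian extension, as the compositum of all finite abelian extensions.\<close>

definition max_abelian_extension :: "'k::field alg_closure set" where
  "max_abelian_extension =
    generate_field ring_of_type_algebra (\<Union>{L. finite_abelian_extension L})"

definition abelian_galois_group :: "('k::field alg_closure \<Rightarrow> 'k alg_closure) monoid" where
  "abelian_galois_group = galois_group max_abelian_extension"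

definition krull_topology :: "('k::field alg_closure \<Rightarrow> 'k alg_closure) topology" where
  "krull_topology = topology_generated_by
    {{\<tau> \<in> carrier abelian_galois_group. \<forall>x\<in>F. \<tau> x = \<sigma> x} | \<sigma> F.
      \<sigma> \<in> carrier abelian_galois_group \<and> finite F \<and> F \<subseteq> max_abelian_extension}"

section \<open>The Artin reciprocity map\<close>

definition places_above ::
    "'k::number_field alg_closure set \<Rightarrow> 'k set \<Rightarrow> 'k alg_closure set set" where
  "places_above L \<pp> = {\<PP> \<in> finite_places L. to_ac ` \<pp> \<subseteq> \<PP>}"

definition ramification_index ::
    "'k::number_field alg_closure set \<Rightarrow> 'k set \<Rightarrow> 'k alg_closure set \<Rightarrow> nat" where
  "ramification_index L \<pp> \<PP> = (GREATEST e. to_ac ` \<pp> \<subseteq> ideal_power (integer_ring L) \<PP> e)"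

definition unramified :: "'k::number_field alg_closure set \<Rightarrow> 'k set \<Rightarrow> bool" where
  "unramified L \<pp> \<longleftrightarrow> (\<forall>\<PP> \<in> places_above L \<pp>. ramification_index L \<pp> \<PP> = 1)"

text \<open>The (arithmetic) Frobenius automorphism of a finite abelian extension at an unramified place.
  For an element of the Galois group, the following property characterizes it.\<close>

definition is_frobenius ::
    "'k::number_field alg_closure set \<Rightarrow> 'k set \<Rightarrow> ('k alg_closure \<Rightarrow> 'k alg_closure) \<Rightarrow> bool"
  where
  "is_frobenius L \<pp> \<sigma> \<longleftrightarrow> \<sigma> \<in> carrier (galois_group L) \<and>
    (\<forall>\<PP> \<in> places_above L \<pp>. \<forall>x \<in> carrier (integer_ring L).
       \<sigma> x - x ^ card (carrier (O\<^sub>K Quot \<pp>)) \<in> \<PP>)"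

text \<open>The global Artin reciprocity map is characterized as the unique continuous homomorphism from
  the idele group to the Galois group of the maximal abelian extension that is trivial on principal
  ideles and that, for every finite abelian extension \<open>L\<close> and every place unramified in \<open>L\<close>, maps
  the ideles given by a uniformizer at this place to automorphisms restricting to the Frobenius
  automorphism of \<open>L\<close>.\<close>

definition artin_reciprocity_map ::
    "('k::number_field idele \<Rightarrow> ('k alg_closure \<Rightarrow> 'k alg_closure)) \<Rightarrow> bool" where
  "artin_reciprocity_map \<theta> \<longleftrightarrow>
    \<theta> \<in> hom ideles abelian_galois_group \<and>
    continuous_map idele_topology krull_topology \<theta> \<and>
    (\<forall>a \<in> carrier O\<^sub>K - {0}. \<forall>b \<in> carrier O\<^sub>K - {0}.
       \<theta> (principal_idele a b) = \<one>\<^bsub>abelian_galois_group\<^esub>) \<and>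
    (\<forall>L. finite_abelian_extension L \<longrightarrow>
       (\<forall>\<pp> \<in> P\<^sub>K. unramified L \<pp> \<longrightarrow>
         (\<forall>\<pi> \<in> carrier (completion \<pp>). valuation \<pp> \<pi> = 1 \<longrightarrow>
            is_frobenius L \<pp> (restrict (\<theta> (local_idele \<pp> \<pi>)) L))))"

definition finite_reciprocity_map ::
    "('k::number_field idele \<Rightarrow> ('k alg_closure \<Rightarrow> 'k alg_closure)) \<Rightarrow>
     'k finite_idele \<Rightarrow> ('k alg_closure \<Rightarrow> 'k alg_closure)" where
  "finite_reciprocity_map \<theta> x = \<theta> (x, \<one>\<^bsub>archimedean_ideles\<^esub>)"

section \<open>The Deligne--Ribet monoid\<close>

text \<open>The parameter \<open>rec\<close> is to be instantiated with the reciprocity map on finite ideles.\<close>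

type_synonym 'k deligne_ribet_pair =
  "('k set \<Rightarrow> 'k local_integer) \<times> ('k alg_closure \<Rightarrow> 'k alg_closure)"

definition deligne_ribet_rel ::
    "('k::number_field finite_idele \<Rightarrow> ('k alg_closure \<Rightarrow> 'k alg_closure)) \<Rightarrow>
     ('k deligne_ribet_pair \<times> 'k deligne_ribet_pair) set" where
  "deligne_ribet_rel rec =
    {((\<rho>, s), (\<rho> \<otimes>\<^bsub>profinite_integers\<^esub> u,
       inv\<^bsub>abelian_galois_group\<^esub> (rec (unit_idele u)) \<otimes>\<^bsub>abelian_galois_group\<^esub> s)) | \<rho> s u.
      \<rho> \<in> carrier profinite_integers \<and> s \<in> carrier abelian_galois_group \<and>
      u \<in> Units profinite_integers}"

definition deligne_ribet_class ::
    "('k::number_field finite_idele \<Rightarrow> ('k alg_closure \<Rightarrow> 'k alg_closure)) \<Rightarrow>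
     ('k set \<Rightarrow> 'k local_integer) \<Rightarrow> ('k alg_closure \<Rightarrow> 'k alg_closure) \<Rightarrow>
     'k deligne_ribet_pair set" where
  "deligne_ribet_class rec \<rho> s = deligne_ribet_rel rec `` {(\<rho>, s)}"

definition deligne_ribet_monoid ::
    "('k::number_field finite_idele \<Rightarrow> ('k alg_closure \<Rightarrow> 'k alg_closure)) \<Rightarrow>
     'k deligne_ribet_pair set monoid" where
  "deligne_ribet_monoid rec =
    \<lparr>carrier = carrier (profinite_integers \<times>\<times> abelian_galois_group) // deligne_ribet_rel rec,
     monoid.mult = (\<lambda>A B. \<Union>x\<in>A. \<Union>y\<in>B.
       deligne_ribet_rel rec `` {x \<otimes>\<^bsub>profinite_integers \<times>\<times> abelian_galois_group\<^esub> y}),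
     monoid.one = deligne_ribet_class rec \<one>\<^bsub>profinite_integers\<^esub> \<one>\<^bsub>abelian_galois_group\<^esub>\<rparr>"

definition standard_idempotent ::
    "('k::number_field finite_idele \<Rightarrow> ('k alg_closure \<Rightarrow> 'k alg_closure)) \<Rightarrow>
     'k set set \<Rightarrow> 'k deligne_ribet_pair set" where
  "standard_idempotent rec S =
    deligne_ribet_class rec (indicator_integer S) \<one>\<^bsub>abelian_galois_group\<^esub>"

definition idempotent_elements :: "('a, 'b) monoid_scheme \<Rightarrow> 'a set" where
  "idempotent_elements M = {e \<in> carrier M. e \<otimes>\<^bsub>M\<^esub> e = e}"

end

theory Submission
  imports Defs
begin

text \<open>If \<open>[\<rho>, s]\<close> is idempotent, there is a unit \<open>u\<close> with \<open>\<rho> = \<rho>\<^sup>2 u\<close> and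
  \<open>s = rec(u)\<inverse> s\<^sup>2\<close>.  Then \<open>s = rec(u)\<close> and \<open>\<rho> u\<close> is idempotent, so
  \<open>[\<rho>, s] = [\<rho> u, 1]\<close>.  Every completion is a local ring, whose only idempotents are \<open>0\<close> and
  \<open>1\<close>; hence \<open>\<rho> u = 1\<^sub>S\<close>, where \<open>S\<close> is the set of places at which \<open>\<rho> u\<close>, equivalently \<open>\<rho>\<close>,
  has valuation \<open>0\<close>.  For the same reason the class of \<open>1\<^sub>S\<close> determines \<open>S\<close>.  That the monoid is
  well defined rests on the commutativity of the Galois group of the maximal abelian extension:
  finite abelian extensions are normal, so two automorphisms commute on each of them and hence on
  their compositum.\<close>

section \<open>Balanced products over the unit group\<close>

text \<open>The quotient by the units is treated abstractly: \<open>M\<close> stands for the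
  multiplicative monoid of profinite integers, \<open>G\<close> for the abelian Galois group and
  \<open>r\<close> for reciprocity on integral unit ideles.\<close>

locale balanced_product = M: comm_monoid M + G: comm_group G
  for M :: "('a, 'c) monoid_scheme" (structure) and G :: "('b, 'd) monoid_scheme" (structure) +
  fixes r :: "'a \<Rightarrow> 'b"
  assumes r_hom: "r \<in> hom (units_of M) G"
begin

text \<open>The orbit relation of the unit group of \<open>M\<close>, in the very shape of
  \<open>deligne_ribet_rel\<close>, so that unfolding identifies the two.\<close>

definition rel :: "(('a \<times> 'b) \<times> ('a \<times> 'b)) set" where
  "rel = {((a, s), (a \<otimes>\<^bsub>M\<^esub> u, inv\<^bsub>G\<^esub> (r u) \<otimes>\<^bsub>G\<^esub> s)) | a s u.
    a \<in> carrier M \<and> s \<in> carrier G \<and> u \<in> Units M}"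

sublocale r: group_hom "units_of M" G r
  using r_hom by (simp add: group_hom_def group_hom_axioms_def M.units_group G.is_group)

lemma r_closed: "u \<in> Units M \<Longrightarrow> r u \<in> carrier G"
  using r.hom_closed by (simp add: units_of_carrier)

lemma r_mult: "u \<in> Units M \<Longrightarrow> v \<in> Units M \<Longrightarrow> r (u \<otimes>\<^bsub>M\<^esub> v) = r u \<otimes>\<^bsub>G\<^esub> r v"
  using r.hom_mult by (simp add: units_of_carrier units_of_mult)

lemma r_one: "r \<one>\<^bsub>M\<^esub> = \<one>\<^bsub>G\<^esub>"
  using r.hom_one by (simp add: units_of_one)

lemma r_inv: "u \<in> Units M \<Longrightarrow> r (inv\<^bsub>M\<^esub> u) = inv\<^bsub>G\<^esub> (r u)"
  using r.hom_inv by (simp add: units_of_carrier M.units_of_inv)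

lemma rel_iff:
  "((a, s), (b, t)) \<in> rel \<longleftrightarrow> a \<in> carrier M \<and> s \<in> carrier G \<and>
    (\<exists>u\<in>Units M. b = a \<otimes>\<^bsub>M\<^esub> u \<and> t = inv\<^bsub>G\<^esub> (r u) \<otimes>\<^bsub>G\<^esub> s)"
  unfolding rel_def by blast

text \<open>Orbits of a group action: the unit \<open>1\<close> gives reflexivity, inverse units
  give symmetry and products of units give transitivity.\<close>

lemma equiv_rel: "equiv (carrier (M \<times>\<times> G)) rel"
proof (rule equivI)
  show "rel \<subseteq> carrier (M \<times>\<times> G) \<times> carrier (M \<times>\<times> G)"
    by (auto simp: rel_def r_closed)
  show "refl_on (carrier (M \<times>\<times> G)) rel"
    by (auto simp: refl_on_def rel_iff r_one intro!: bexI[of _ "\<one>\<^bsub>M\<^esub>"])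
  show "sym rel"
  proof (rule symI, clarify)
    fix a s b t assume "((a, s), (b, t)) \<in> rel"
    then obtain u where u: "a \<in> carrier M" "s \<in> carrier G" "u \<in> Units M"
      "b = a \<otimes>\<^bsub>M\<^esub> u" "t = inv\<^bsub>G\<^esub> (r u) \<otimes>\<^bsub>G\<^esub> s" by (auto simp: rel_iff)
    have "a = b \<otimes>\<^bsub>M\<^esub> inv\<^bsub>M\<^esub> u" using u M.Units_closed[OF u(3)] by (simp add: M.m_assoc)
    moreover have "s = inv\<^bsub>G\<^esub> (r (inv\<^bsub>M\<^esub> u)) \<otimes>\<^bsub>G\<^esub> t"
      using u by (simp add: r_inv r_closed G.m_assoc[symmetric])
    ultimately show "((b, t), (a, s)) \<in> rel"
      using u by (auto simp: rel_iff r_closed)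
  qed
  show "trans rel"
  proof (rule transI, clarify)
    fix a s b t c w assume "((a, s), (b, t)) \<in> rel" "((b, t), (c, w)) \<in> rel"
    then obtain u v where u: "a \<in> carrier M" "s \<in> carrier G" "u \<in> Units M" "v \<in> Units M"
      "b = a \<otimes>\<^bsub>M\<^esub> u" "t = inv\<^bsub>G\<^esub> (r u) \<otimes>\<^bsub>G\<^esub> s"
      "c = b \<otimes>\<^bsub>M\<^esub> v" "w = inv\<^bsub>G\<^esub> (r v) \<otimes>\<^bsub>G\<^esub> t" by (auto simp: rel_iff)
    have "c = a \<otimes>\<^bsub>M\<^esub> (u \<otimes>\<^bsub>M\<^esub> v)" using u M.Units_closed by (simp add: M.m_assoc)
    moreover have "w = inv\<^bsub>G\<^esub> (r (u \<otimes>\<^bsub>M\<^esub> v)) \<otimes>\<^bsub>G\<^esub> s"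
      using u by (simp add: r_mult r_closed G.m_assoc G.inv_mult_group)
    ultimately show "((a, s), (c, w)) \<in> rel" using u by (auto simp: rel_iff)
  qed
qed

lemma class_eq_iff:
  assumes "a \<in> carrier M" "s \<in> carrier G" "b \<in> carrier M" "t \<in> carrier G"
  shows "rel `` {(a, s)} = rel `` {(b, t)} \<longleftrightarrow>
    (\<exists>u\<in>Units M. b = a \<otimes>\<^bsub>M\<^esub> u \<and> t = inv\<^bsub>G\<^esub> (r u) \<otimes>\<^bsub>G\<^esub> s)"
  using assms by (subst eq_equiv_class_iff[OF equiv_rel]) (auto simp: rel_iff)

text \<open>The product in \<open>deligne_ribet_monoid\<close> is a union over all representatives.
  It collapses to one class because commutativity of \<open>M\<close> and of \<open>G\<close> lets
  the two unit factors be collected into the single unit \<open>u v\<close>.\<close>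

lemma class_mult:
  assumes "a \<in> carrier M" "s \<in> carrier G" "b \<in> carrier M" "t \<in> carrier G"
  shows "(\<Union>x\<in>rel `` {(a, s)}. \<Union>y\<in>rel `` {(b, t)}. rel `` {x \<otimes>\<^bsub>M \<times>\<times> G\<^esub> y}) =
    rel `` {(a \<otimes>\<^bsub>M\<^esub> b, s \<otimes>\<^bsub>G\<^esub> t)}"
proof -
  have "rel `` {x \<otimes>\<^bsub>M \<times>\<times> G\<^esub> y} = rel `` {(a \<otimes>\<^bsub>M\<^esub> b, s \<otimes>\<^bsub>G\<^esub> t)}"
    if xy: "x \<in> rel `` {(a, s)}" "y \<in> rel `` {(b, t)}" for x y
  proof -
    obtain u v where u: "u \<in> Units M" "v \<in> Units M"
      "x = (a \<otimes>\<^bsub>M\<^esub> u, inv\<^bsub>G\<^esub> (r u) \<otimes>\<^bsub>G\<^esub> s)" "y = (b \<otimes>\<^bsub>M\<^esub> v, inv\<^bsub>G\<^esub> (r v) \<otimes>\<^bsub>G\<^esub> t)"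
      using xy by (auto simp: rel_def)
    have "(a \<otimes>\<^bsub>M\<^esub> u) \<otimes>\<^bsub>M\<^esub> (b \<otimes>\<^bsub>M\<^esub> v) = (a \<otimes>\<^bsub>M\<^esub> b) \<otimes>\<^bsub>M\<^esub> (u \<otimes>\<^bsub>M\<^esub> v)"
      using assms u(1,2)[THEN M.Units_closed] by (simp add: M.m_ac)
    moreover have "(inv\<^bsub>G\<^esub> (r u) \<otimes>\<^bsub>G\<^esub> s) \<otimes>\<^bsub>G\<^esub> (inv\<^bsub>G\<^esub> (r v) \<otimes>\<^bsub>G\<^esub> t) =
        inv\<^bsub>G\<^esub> (r (u \<otimes>\<^bsub>M\<^esub> v)) \<otimes>\<^bsub>G\<^esub> (s \<otimes>\<^bsub>G\<^esub> t)"
      using assms u by (simp add: r_mult r_closed G.m_ac G.inv_mult)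
    ultimately have "((a \<otimes>\<^bsub>M\<^esub> b, s \<otimes>\<^bsub>G\<^esub> t), x \<otimes>\<^bsub>M \<times>\<times> G\<^esub> y) \<in> rel"
      using assms u by (auto simp: rel_iff)
    then show ?thesis using equiv_class_eq[OF equiv_rel] by blast
  qed
  moreover have "(a, s) \<in> rel `` {(a, s)}" "(b, t) \<in> rel `` {(b, t)}"
    using assms equiv_class_self[OF equiv_rel] by auto
  ultimately show ?thesis by blast
qed

text \<open>Idempotency supplies a unit \<open>u\<close> with \<open>a = a a u\<close> and
  \<open>s = inv (r u) s s\<close>. Cancelling \<open>s\<close> in the group gives
  \<open>s = r u\<close>, so acting by this same \<open>u\<close> makes the second coordinate
  trivial and the first one idempotent.\<close>

lemma idempotent_class:
  assumes "a \<in> carrier M" "s \<in> carrier G"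
    and "rel `` {(a \<otimes>\<^bsub>M\<^esub> a, s \<otimes>\<^bsub>G\<^esub> s)} = rel `` {(a, s)}"
  obtains u where "u \<in> Units M" "(a \<otimes>\<^bsub>M\<^esub> u) \<otimes>\<^bsub>M\<^esub> (a \<otimes>\<^bsub>M\<^esub> u) = a \<otimes>\<^bsub>M\<^esub> u"
    "rel `` {(a, s)} = rel `` {(a \<otimes>\<^bsub>M\<^esub> u, \<one>\<^bsub>G\<^esub>)}"
proof -
  obtain u where u: "u \<in> Units M" "a = (a \<otimes>\<^bsub>M\<^esub> a) \<otimes>\<^bsub>M\<^esub> u"
    "s = inv\<^bsub>G\<^esub> (r u) \<otimes>\<^bsub>G\<^esub> (s \<otimes>\<^bsub>G\<^esub> s)"
    using assms by (auto simp: class_eq_iff)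
  have "inv\<^bsub>G\<^esub> (r u) \<otimes>\<^bsub>G\<^esub> s = \<one>\<^bsub>G\<^esub>"
  proof -
    have "(inv\<^bsub>G\<^esub> (r u) \<otimes>\<^bsub>G\<^esub> s) \<otimes>\<^bsub>G\<^esub> s = s"
      using u(1) u(3)[symmetric] assms by (simp add: r_closed G.m_assoc)
    then show ?thesis using u assms by (simp add: r_closed)
  qed
  moreover have "(a \<otimes>\<^bsub>M\<^esub> u) \<otimes>\<^bsub>M\<^esub> (a \<otimes>\<^bsub>M\<^esub> u) = ((a \<otimes>\<^bsub>M\<^esub> a) \<otimes>\<^bsub>M\<^esub> u) \<otimes>\<^bsub>M\<^esub> u"
    using assms u(1) M.Units_closed[OF u(1)] by (simp add: M.m_ac)
  ultimately show ?thesis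
    using u(1,2) assms M.Units_closed[OF u(1)]
    by (intro that[OF u(1)]) (simp, subst class_eq_iff, auto intro!: bexI[of _ u])
qed

end

section \<open>Fractions\<close>

context cring begin

text \<open>The difference \<open>x - y\<close> is annihilated by \<open>b\<close>, hence
  zero.\<close>

lemma regular_elements_cancel:
  assumes "b \<in> regular_elements R" "x \<in> carrier R" "y \<in> carrier R" "x \<otimes> b = y \<otimes> b"
  shows "x = y"
proof -
  have b: "b \<in> carrier R" using assms(1) by (simp add: regular_elements_def)
  have "(x \<ominus> y) \<otimes> b = \<zero>"
    using assms b by (simp add: minus_eq l_distr l_minus r_neg)
  moreover have "x \<ominus> y \<in> carrier R" using assms by simp
  ultimately have "x \<ominus> y = \<zero>"
    using assms(1) unfolding regular_elements_def by blast
  then show ?thesis using assms by simp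
qed

lemma regular_elements_closed:
  "b \<in> regular_elements R \<Longrightarrow> b \<in> carrier R"
  by (simp add: regular_elements_def)

lemma regular_elements_mult:
  assumes "b \<in> regular_elements R" "c \<in> regular_elements R"
  shows "b \<otimes> c \<in> regular_elements R"
proof -
  have *: "b \<in> carrier R" "c \<in> carrier R"
    using assms by (simp_all add: regular_elements_closed)
  have "a = \<zero>" if a: "a \<in> carrier R" "a \<otimes> (b \<otimes> c) = \<zero>" for a
  proof -
    have "(a \<otimes> b) \<otimes> c = \<zero>" using a * by (simp add: m_assoc)
    then have "a \<otimes> b = \<zero>"
      using assms(2) m_closed[OF a(1) *(1)] unfolding regular_elements_def by blast
    then show ?thesis using assms(1) a(1) unfolding regular_elements_def by blast
  qed
  then show ?thesis using * by (simp add: regular_elements_def)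
qed

lemma one_regular: "\<one> \<in> regular_elements R"
  by (simp add: regular_elements_def)

text \<open>Transitivity is the nontrivial law: the middle denominator \<open>d\<close> is regular
  and can be cancelled.\<close>

lemma equiv_fraction_rel: "equiv (carrier R \<times> regular_elements R) (fraction_rel R)"
proof (rule equivI)
  show "fraction_rel R \<subseteq> (carrier R \<times> regular_elements R) \<times> (carrier R \<times> regular_elements R)"
    by (auto simp: fraction_rel_def)
  show "refl_on (carrier R \<times> regular_elements R) (fraction_rel R)"
    by (auto simp: refl_on_def fraction_rel_def)
  show "sym (fraction_rel R)"
    by (auto simp: sym_def fraction_rel_def)
  show "trans (fraction_rel R)"
  proof (rule transI, clarify)
    fix a b c d e f
    assume "((a, b), (c, d)) \<in> fraction_rel R" "((c, d), (e, f)) \<in> fraction_rel R"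
    then have *: "a \<in> carrier R" "b \<in> regular_elements R" "c \<in> carrier R" "d \<in> regular_elements R"
      "e \<in> carrier R" "f \<in> regular_elements R" "a \<otimes> d = c \<otimes> b" "c \<otimes> f = e \<otimes> d"
      by (auto simp: fraction_rel_def)
    note carr = *(1,3,5) *(2,4,6)[THEN regular_elements_closed]
    have "(a \<otimes> f) \<otimes> d = (a \<otimes> d) \<otimes> f" using carr by (simp add: m_ac)
    also have "\<dots> = (c \<otimes> f) \<otimes> b" unfolding *(7) using carr by (simp add: m_ac)
    also have "\<dots> = (e \<otimes> b) \<otimes> d" unfolding *(8) using carr by (simp add: m_ac)
    finally have "a \<otimes> f = e \<otimes> b" using regular_elements_cancel[OF *(4)] carr by simp
    then show "((a, b), (e, f)) \<in> fraction_rel R" using * by (simp add: fraction_rel_def)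
  qed
qed

lemma fraction_in_carrier:
  "a \<in> carrier R \<Longrightarrow> b \<in> regular_elements R \<Longrightarrow> fraction R a b \<in> carrier (fraction_ring R)"
  by (auto simp: fraction_def fraction_ring_def intro!: quotientI)

lemma one_fraction_ring: "\<one>\<^bsub>fraction_ring R\<^esub> = fraction R \<one> \<one>"
  by (simp add: fraction_ring_def)

text \<open>As in \<open>class_mult\<close>, every choice of representatives gives the same class,
  so the union in \<open>fraction_ring\<close> is a single fraction.\<close>

lemma fraction_mult:
  assumes "a \<in> carrier R" "b \<in> regular_elements R" "c \<in> carrier R" "d \<in> regular_elements R"
  shows "fraction R a b \<otimes>\<^bsub>fraction_ring R\<^esub> fraction R c d = fraction R (a \<otimes> c) (b \<otimes> d)"
proof -
  have "fraction R (fst x \<otimes> fst y) (snd x \<otimes> snd y) = fraction R (a \<otimes> c) (b \<otimes> d)"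
    if "x \<in> fraction R a b" "y \<in> fraction R c d" for x y
  proof -
    obtain a' b' c' d' where xy: "x = (a', b')" "y = (c', d')" by (cases x, cases y)
    have *: "a' \<in> carrier R" "b' \<in> regular_elements R" "a \<otimes> b' = a' \<otimes> b"
      "c' \<in> carrier R" "d' \<in> regular_elements R" "c \<otimes> d' = c' \<otimes> d"
      using that by (auto simp: fraction_def fraction_rel_def xy)
    note carr = assms(1,3) *(1,4) assms(2,4)[THEN regular_elements_closed]
      *(2,5)[THEN regular_elements_closed]
    have "(a \<otimes> c) \<otimes> (b' \<otimes> d') = (a \<otimes> b') \<otimes> (c \<otimes> d')" using carr by (simp add: m_ac)
    also have "\<dots> = (a' \<otimes> c') \<otimes> (b \<otimes> d)" unfolding *(3,6) using carr by (simp add: m_ac)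
    finally have "((a \<otimes> c, b \<otimes> d), (a' \<otimes> c', b' \<otimes> d')) \<in> fraction_rel R"
      using assms * by (simp add: fraction_rel_def regular_elements_mult)
    then show ?thesis
      using equiv_class_eq[OF equiv_fraction_rel] by (simp add: fraction_def xy)
  qed
  then have "(\<Union>x\<in>fraction R a b. \<Union>y\<in>fraction R c d.
      fraction R (fst x \<otimes> fst y) (snd x \<otimes> snd y)) =
    (\<Union>x\<in>fraction R a b. \<Union>y\<in>fraction R c d. fraction R (a \<otimes> c) (b \<otimes> d))"
    by (intro SUP_cong refl)
  moreover have "(a, b) \<in> fraction R a b" "(c, d) \<in> fraction R c d"
    using assms by (auto simp: fraction_def fraction_rel_def)
  ultimately show ?thesis unfolding fraction_ring_def by auto
qed

text \<open>Its inverse is the fraction of \<open>inv u\<close>; this places local units in the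
  multiplicative group of the local field.\<close>

lemma fraction_one_in_Units:
  assumes "u \<in> Units R"
  shows "fraction R u \<one> \<in> Units (fraction_ring R)"
proof -
  have "fraction R u \<one> \<otimes>\<^bsub>fraction_ring R\<^esub> fraction R (inv u) \<one> = \<one>\<^bsub>fraction_ring R\<^esub>"
    "fraction R (inv u) \<one> \<otimes>\<^bsub>fraction_ring R\<^esub> fraction R u \<one> = \<one>\<^bsub>fraction_ring R\<^esub>"
    using assms by (simp_all add: fraction_mult one_regular Units_closed one_fraction_ring)
  moreover have "fraction R u \<one> \<in> carrier (fraction_ring R)"
    "fraction R (inv u) \<one> \<in> carrier (fraction_ring R)"
    using assms by (simp_all add: fraction_in_carrier one_regular Units_closed)
  ultimately show ?thesis
    unfolding Units_def by blast
qed
end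

section \<open>Completions\<close>

context cring begin

lemma ideal_power_0: "ideal_power R I 0 = carrier R"
  by (simp add: ideal_power_def ideals_set_def nat_pow_def)

lemma ideal_power_Suc: "ideal_power R I (Suc n) = ideal_prod R (ideal_power R I n) I"
  by (simp add: ideal_power_def ideals_set_def nat_pow_def)

lemma ideal_ideal_power:
  assumes "ideal I R"
  shows "ideal (ideal_power R I n) R"
  by (induction n)
    (auto simp: ideal_power_0 ideal_power_Suc oneideal intro: ideal_prod_is_ideal assms)

lemma ideal_power_1:
  assumes "ideal I R"
  shows "ideal_power R I 1 = I"
  using ideal_prod_commute[OF oneideal assms] ideal_prod_one[OF assms]
  by (simp add: ideal_power_Suc ideal_power_0)

lemma ideal_power_antimono:
  assumes "ideal I R" "m \<le> n"
  shows "ideal_power R I n \<subseteq> ideal_power R I m"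
  using assms(2)
proof (induction n rule: dec_induct)
  case (step n)
  then show ?case
    using ideal_prod_inter[OF ideal_ideal_power[OF assms(1)] assms(1), of n]
    by (auto simp: ideal_power_Suc)
qed simp

lemma nat_pow_in_ideal_power:
  assumes "ideal I R" "a \<in> I"
  shows "a [^] n \<in> ideal_power R I n"
  by (induction n) (auto simp: ideal_power_0 ideal_power_Suc intro: ideal_prod.prod assms)

end

text \<open>Translates vanishing in a quotient ring, whose zero is the coset \<open>I\<close>
  itself, into membership in the ideal.\<close>

lemma (in ideal) a_rcos_eq_self_iff:
  assumes "a \<in> carrier R"
  shows "I +> a = I \<longleftrightarrow> a \<in> I"
  using a_rcos_const a_rcos_self[OF assms] by blast

text \<open>The locale of maximal ideals already asserts that the ambient structure is a ring, so closure of
  the algebraic integers under addition and multiplication need not be proved; if there are no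
  places, the products over them are trivial.\<close>

lemma cring_integer_ring:
  assumes "P \<in> finite_places L"
  shows "cring (integer_ring L)"
proof -
  interpret maximalideal P "integer_ring L"
    using assms by (simp add: finite_places_def)
  show ?thesis
    by unfold_locales (simp add: integer_ring_def ring_of_type_algebra_def mult.commute)
qed

section \<open>The completion at a place as a commutative ring\<close>

abbreviation place_power :: "'k::number_field set \<Rightarrow> nat \<Rightarrow> 'k set" where
  "place_power \<pp> n \<equiv> ideal_power O\<^sub>K \<pp> n"

context
  fixes \<pp> :: "'k::number_field set"
  assumes place: "\<pp> \<in> P\<^sub>K"
begin

lemma maximalideal_place: "maximalideal \<pp> O\<^sub>K"
  using place by (simp add: finite_places_def)

lemma cring_O\<^sub>K: "cring (O\<^sub>K :: 'k ring)"
  using cring_integer_ring[OF place] .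

lemma ideal_place: "ideal \<pp> O\<^sub>K"
  using maximalideal_place by (rule maximalideal.axioms)

lemma ideal_place_power: "ideal (place_power \<pp> n) O\<^sub>K"
  by (rule cring.ideal_ideal_power[OF cring_O\<^sub>K ideal_place])

lemma cring_residue_ring_pow: "cring (residue_ring_pow \<pp> n)"
  by (rule ideal.quotient_is_cring[OF ideal_place_power cring_O\<^sub>K])

lemma ring_hom_residue_ring_pow:
  "ring_hom_cring O\<^sub>K (residue_ring_pow \<pp> n) (a_r_coset O\<^sub>K (place_power \<pp> n))"
  by (rule ideal.rcos_ring_hom_cring[OF ideal_place_power cring_O\<^sub>K])

text \<open>The first power of the place is the place itself, which is maximal and therefore
  prime.\<close>

lemma domain_residue_ring: "domain (residue_ring_pow \<pp> 1)"
  unfolding cring.ideal_power_1[OF cring_O\<^sub>K ideal_place]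
  by (rule primeideal.quotient_is_domain[OF cring.maximalideal_prime[OF cring_O\<^sub>K maximalideal_place]])

lemma carrier_residue_ring_pow:
  "carrier (residue_ring_pow \<pp> n) = a_r_coset O\<^sub>K (place_power \<pp> n) ` carrier O\<^sub>K"
  by (auto simp: FactRing_def A_RCOSETS_def')

lemma completion_component:
  "x \<in> carrier (completion \<pp>) \<Longrightarrow> x n \<in> carrier (residue_ring_pow \<pp> n)"
  by (simp add: completion_def)

text \<open>Representing \<open>x\<close> at the top level \<open>n\<close> suffices: the coset
  there is contained in every lower component, and cosets of one ideal that meet are equal.\<close>

lemma completion_representative:
  assumes "x \<in> carrier (completion \<pp>)"
  obtains a where "a \<in> carrier O\<^sub>K" "\<And>m. m \<le> n \<Longrightarrow> x m = place_power \<pp> m +>\<^bsub>O\<^sub>K\<^esub> a"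
proof -
  have x: "x m \<in> a_r_coset O\<^sub>K (place_power \<pp> m) ` carrier O\<^sub>K" "x (Suc m) \<subseteq> x m" for m
    using assms unfolding completion_def carrier_residue_ring_pow by auto
  have coset: "abelian_subgroup (place_power \<pp> m) (O\<^sub>K :: 'k ring)" for m
    by (rule abelian_subgroupI3)
      (use ideal_place_power ring.is_abelian_group in \<open>auto simp: ideal_def\<close>)
  obtain a where a: "a \<in> carrier O\<^sub>K" "x n = place_power \<pp> n +>\<^bsub>O\<^sub>K\<^esub> a"
    using x(1)[of n] by (elim imageE)
  have "x m = place_power \<pp> m +>\<^bsub>O\<^sub>K\<^esub> a" if "m \<le> n" for m
  proof -
    have "x n \<subseteq> x m"
      using that x(2) by (rule lift_Suc_antimono_le[rotated])
    then have "a \<in> x m" using abelian_subgroup.a_rcos_self[OF coset a(1)] a(2) by blast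
    moreover obtain b where b: "b \<in> carrier O\<^sub>K" "x m = place_power \<pp> m +>\<^bsub>O\<^sub>K\<^esub> b"
      using x(1)[of m] by (elim imageE)
    ultimately show ?thesis
      using abelian_subgroup.a_repr_independence'[OF coset _ b(1), of a m] by simp
  qed
  then show ?thesis using that a by blast
qed

text \<open>The transition condition compares level \<open>n\<close> with level
  \<open>Suc n\<close>, so a representative common to these two is enough; the inclusion of cosets
  then follows from that of the ideal powers.\<close>

lemma completionI:
  assumes "\<And>n. \<exists>a\<in>carrier O\<^sub>K. x n = place_power \<pp> n +>\<^bsub>O\<^sub>K\<^esub> a \<and>
    x (Suc n) = place_power \<pp> (Suc n) +>\<^bsub>O\<^sub>K\<^esub> a"
  shows "x \<in> carrier (completion \<pp>)"
proof -
  have "x n \<in> carrier (residue_ring_pow \<pp> n) \<and> x (Suc n) \<subseteq> x n" for n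
  proof -
    obtain a where a: "a \<in> carrier O\<^sub>K" "x n = place_power \<pp> n +>\<^bsub>O\<^sub>K\<^esub> a"
      "x (Suc n) = place_power \<pp> (Suc n) +>\<^bsub>O\<^sub>K\<^esub> a"
      using assms by blast
    have "place_power \<pp> (Suc n) \<subseteq> place_power \<pp> n"
      by (rule cring.ideal_power_antimono[OF cring_O\<^sub>K ideal_place]) simp
    then show ?thesis using a unfolding carrier_residue_ring_pow by (auto simp: a_r_coset_def')
  qed
  then show ?thesis by (simp add: completion_def)
qed

lemma completion_simps:
  "(x \<otimes>\<^bsub>completion \<pp>\<^esub> y) n = x n \<otimes>\<^bsub>residue_ring_pow \<pp> n\<^esub> y n"
  "(x \<oplus>\<^bsub>completion \<pp>\<^esub> y) n = x n \<oplus>\<^bsub>residue_ring_pow \<pp> n\<^esub> y n"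
  "\<one>\<^bsub>completion \<pp>\<^esub> n = \<one>\<^bsub>residue_ring_pow \<pp> n\<^esub>"
  "\<zero>\<^bsub>completion \<pp>\<^esub> n = \<zero>\<^bsub>residue_ring_pow \<pp> n\<^esub>"
  by (simp_all add: completion_def)

text \<open>Each operation is performed on representatives shared by levels \<open>n\<close> and
  \<open>Suc n\<close>. The negative is a family of levelwise negatives because the additive group
  structure of \<open>completion\<close> is not yet established.\<close>

lemma completion_closed:
  assumes x: "x \<in> carrier (completion \<pp>)" and y: "y \<in> carrier (completion \<pp>)"
  shows "x \<otimes>\<^bsub>completion \<pp>\<^esub> y \<in> carrier (completion \<pp>)"
    and "x \<oplus>\<^bsub>completion \<pp>\<^esub> y \<in> carrier (completion \<pp>)"
    and "(\<lambda>n. \<ominus>\<^bsub>residue_ring_pow \<pp> n\<^esub> x n) \<in> carrier (completion \<pp>)"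
proof -
  note pr = ring_hom_residue_ring_pow and O = cring_O\<^sub>K
    and hom = ideal.rcos_ring_hom[OF ideal_place_power]
  have rep: "\<exists>a\<in>carrier O\<^sub>K. \<exists>b\<in>carrier O\<^sub>K. \<forall>m\<le>Suc n.
      x m = place_power \<pp> m +>\<^bsub>O\<^sub>K\<^esub> a \<and> y m = place_power \<pp> m +>\<^bsub>O\<^sub>K\<^esub> b" for n
    by (rule completion_representative[OF x, of "Suc n"],
        rule completion_representative[OF y, of "Suc n"]) blast
  show "x \<otimes>\<^bsub>completion \<pp>\<^esub> y \<in> carrier (completion \<pp>)"
  proof (rule completionI)
    fix n
    obtain a b where "a \<in> carrier O\<^sub>K" "b \<in> carrier O\<^sub>K" "\<forall>m\<le>Suc n.
      x m = place_power \<pp> m +>\<^bsub>O\<^sub>K\<^esub> a \<and> y m = place_power \<pp> m +>\<^bsub>O\<^sub>K\<^esub> b"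
      using rep[of n] by (elim bexE)
    then show "\<exists>c\<in>carrier O\<^sub>K. (x \<otimes>\<^bsub>completion \<pp>\<^esub> y) n = place_power \<pp> n +>\<^bsub>O\<^sub>K\<^esub> c \<and>
        (x \<otimes>\<^bsub>completion \<pp>\<^esub> y) (Suc n) = place_power \<pp> (Suc n) +>\<^bsub>O\<^sub>K\<^esub> c"
      by (intro bexI[of _ "a \<otimes>\<^bsub>O\<^sub>K\<^esub> b"])
        (simp_all add: completion_simps ring_hom_mult[OF hom] cring.cring_simprules[OF O])
  qed
  show "x \<oplus>\<^bsub>completion \<pp>\<^esub> y \<in> carrier (completion \<pp>)"
  proof (rule completionI)
    fix n
    obtain a b where "a \<in> carrier O\<^sub>K" "b \<in> carrier O\<^sub>K" "\<forall>m\<le>Suc n.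
      x m = place_power \<pp> m +>\<^bsub>O\<^sub>K\<^esub> a \<and> y m = place_power \<pp> m +>\<^bsub>O\<^sub>K\<^esub> b"
      using rep[of n] by (elim bexE)
    then show "\<exists>c\<in>carrier O\<^sub>K. (x \<oplus>\<^bsub>completion \<pp>\<^esub> y) n = place_power \<pp> n +>\<^bsub>O\<^sub>K\<^esub> c \<and>
        (x \<oplus>\<^bsub>completion \<pp>\<^esub> y) (Suc n) = place_power \<pp> (Suc n) +>\<^bsub>O\<^sub>K\<^esub> c"
      by (intro bexI[of _ "a \<oplus>\<^bsub>O\<^sub>K\<^esub> b"])
        (simp_all add: completion_simps ring_hom_add[OF hom] cring.cring_simprules[OF O])
  qed
  show "(\<lambda>n. \<ominus>\<^bsub>residue_ring_pow \<pp> n\<^esub> x n) \<in> carrier (completion \<pp>)"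
  proof (rule completionI)
    fix n
    obtain a where "a \<in> carrier O\<^sub>K" "\<And>m. m \<le> Suc n \<Longrightarrow> x m = place_power \<pp> m +>\<^bsub>O\<^sub>K\<^esub> a"
      using completion_representative[OF x, of "Suc n"] by blast
    then show "\<exists>c\<in>carrier O\<^sub>K. \<ominus>\<^bsub>residue_ring_pow \<pp> n\<^esub> x n = place_power \<pp> n +>\<^bsub>O\<^sub>K\<^esub> c \<and>
        \<ominus>\<^bsub>residue_ring_pow \<pp> (Suc n)\<^esub> x (Suc n) = place_power \<pp> (Suc n) +>\<^bsub>O\<^sub>K\<^esub> c"
      by (intro bexI[of _ "\<ominus>\<^bsub>O\<^sub>K\<^esub> a"])
        (simp_all add: ring_hom_cring.hom_a_inv[OF pr] cring.cring_simprules[OF O])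
  qed
qed

lemma completion_one_zero_closed:
  "\<one>\<^bsub>completion \<pp>\<^esub> \<in> carrier (completion \<pp>)"
  "\<zero>\<^bsub>completion \<pp>\<^esub> \<in> carrier (completion \<pp>)"
proof -
  note pr = ring_hom_residue_ring_pow and O = cring_O\<^sub>K
    and hom = ideal.rcos_ring_hom[OF ideal_place_power]
  show "\<one>\<^bsub>completion \<pp>\<^esub> \<in> carrier (completion \<pp>)"
    by (rule completionI, intro bexI[of _ "\<one>\<^bsub>O\<^sub>K\<^esub>"])
      (simp_all add: completion_simps ring_hom_one[OF hom] cring.cring_simprules[OF O])
  show "\<zero>\<^bsub>completion \<pp>\<^esub> \<in> carrier (completion \<pp>)"
    by (rule completionI, intro bexI[of _ "\<zero>\<^bsub>O\<^sub>K\<^esub>"])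
      (simp_all add: completion_simps ring_hom_cring.hom_zero[OF pr] cring.cring_simprules[OF O])
qed

text \<open>Each ring law is checked level by level in the quotient rings.\<close>

lemma cring_completion: "cring (completion \<pp>)"
proof -
  note Q = cring.cring_simprules[OF cring_residue_ring_pow]
  show ?thesis
  proof (rule cringI)
    show "abelian_group (completion \<pp>)"
    proof (rule abelian_groupI)
      fix x y z assume *: "x \<in> carrier (completion \<pp>)" "y \<in> carrier (completion \<pp>)"
        "z \<in> carrier (completion \<pp>)"
      show "x \<oplus>\<^bsub>completion \<pp>\<^esub> y \<oplus>\<^bsub>completion \<pp>\<^esub> z =
          x \<oplus>\<^bsub>completion \<pp>\<^esub> (y \<oplus>\<^bsub>completion \<pp>\<^esub> z)"
        by (rule ext) (simp only: completion_simps Q(7) *[THEN completion_component])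
    next
      fix x y assume *: "x \<in> carrier (completion \<pp>)" "y \<in> carrier (completion \<pp>)"
      show "x \<oplus>\<^bsub>completion \<pp>\<^esub> y \<in> carrier (completion \<pp>)" using completion_closed * by blast
      show "x \<oplus>\<^bsub>completion \<pp>\<^esub> y = y \<oplus>\<^bsub>completion \<pp>\<^esub> x"
        by (rule ext) (simp add: completion_simps Q *[THEN completion_component])
    next
      fix x assume *: "x \<in> carrier (completion \<pp>)"
      show "\<zero>\<^bsub>completion \<pp>\<^esub> \<oplus>\<^bsub>completion \<pp>\<^esub> x = x"
        by (rule ext) (simp add: completion_simps Q *[THEN completion_component])
      show "\<exists>y\<in>carrier (completion \<pp>). y \<oplus>\<^bsub>completion \<pp>\<^esub> x = \<zero>\<^bsub>completion \<pp>\<^esub>"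
        \<comment> \<open>The family of levelwise negatives is the witness for the additive
          inverse.\<close>
        using completion_closed(3)[OF * *]
        by (rule bexI[rotated]) (rule ext, simp add: completion_simps Q *[THEN completion_component])
    qed (rule completion_one_zero_closed)
    show "comm_monoid (completion \<pp>)"
    proof (rule comm_monoidI)
      fix x y z assume *: "x \<in> carrier (completion \<pp>)" "y \<in> carrier (completion \<pp>)"
        "z \<in> carrier (completion \<pp>)"
      show "x \<otimes>\<^bsub>completion \<pp>\<^esub> y \<otimes>\<^bsub>completion \<pp>\<^esub> z =
          x \<otimes>\<^bsub>completion \<pp>\<^esub> (y \<otimes>\<^bsub>completion \<pp>\<^esub> z)"
        by (rule ext) (simp add: completion_simps Q *[THEN completion_component])
    next
      fix x y assume *: "x \<in> carrier (completion \<pp>)" "y \<in> carrier (completion \<pp>)"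
      show "x \<otimes>\<^bsub>completion \<pp>\<^esub> y \<in> carrier (completion \<pp>)" using completion_closed * by blast
      show "x \<otimes>\<^bsub>completion \<pp>\<^esub> y = y \<otimes>\<^bsub>completion \<pp>\<^esub> x"
        by (rule ext) (simp add: completion_simps Q *[THEN completion_component])
    next
      fix x assume *: "x \<in> carrier (completion \<pp>)"
      show "\<one>\<^bsub>completion \<pp>\<^esub> \<otimes>\<^bsub>completion \<pp>\<^esub> x = x"
        by (rule ext) (simp only: completion_simps Q(12) *[THEN completion_component])
    qed (rule completion_one_zero_closed)
    fix x y z assume *: "x \<in> carrier (completion \<pp>)" "y \<in> carrier (completion \<pp>)"
      "z \<in> carrier (completion \<pp>)"
    show "(x \<oplus>\<^bsub>completion \<pp>\<^esub> y) \<otimes>\<^bsub>completion \<pp>\<^esub> z =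
        x \<otimes>\<^bsub>completion \<pp>\<^esub> z \<oplus>\<^bsub>completion \<pp>\<^esub> y \<otimes>\<^bsub>completion \<pp>\<^esub> z"
      by (rule ext) (simp add: completion_simps Q *[THEN completion_component])
  qed
qed

section \<open>Idempotents and valuations in a completion\<close>

text \<open>If \<open>x\<close> is idempotent and \<open>a\<close> represents it modulo \<open>\<pp>\<^sup>n\<close>, then so does \<open>a\<^sup>n\<close>; hence \<open>x\<close>
  vanishes modulo \<open>\<pp>\<^sup>n\<close> as soon as \<open>a \<in> \<pp>\<close>.\<close>

lemma completion_idempotent_eq_zero:
  assumes x: "x \<in> carrier (completion \<pp>)" "x \<otimes>\<^bsub>completion \<pp>\<^esub> x = x"
    and x1: "x 1 = \<zero>\<^bsub>residue_ring_pow \<pp> 1\<^esub>"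
  shows "x = \<zero>\<^bsub>completion \<pp>\<^esub>"
proof (rule ext)
  fix n
  interpret O: cring "O\<^sub>K :: 'k ring" by (rule cring_O\<^sub>K)
  \<comment> \<open>The bound \<open>max n 1\<close> keeps level 1, where \<open>x\<close> is known
    to vanish, within reach when \<open>n = 0\<close>.\<close>
  obtain a where a: "a \<in> carrier O\<^sub>K"
    and xa: "\<And>m. m \<le> max n 1 \<Longrightarrow> x m = place_power \<pp> m +>\<^bsub>O\<^sub>K\<^esub> a"
    using completion_representative[OF x(1), of "max n 1"] by blast
  have "\<pp> +>\<^bsub>O\<^sub>K\<^esub> a = \<pp>"
    using xa[of 1] x1 by (simp add: FactRing_def O.ideal_power_1[OF ideal_place, simplified])
  then have "a \<in> \<pp>" using ideal.a_rcos_eq_self_iff[OF ideal_place a] by simp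
  \<comment> \<open>The exponent is \<open>Suc n\<close> because the induction below starts from the
    first power, \<open>a\<close> itself, which represents \<open>x\<close> at level
    \<open>n\<close>.\<close>
  then have "a [^]\<^bsub>O\<^sub>K\<^esub> Suc n \<in> place_power \<pp> (Suc n)"
    by (rule O.nat_pow_in_ideal_power[OF ideal_place])
  also have "\<dots> \<subseteq> place_power \<pp> n" by (rule O.ideal_power_antimono[OF ideal_place]) simp
  finally have "place_power \<pp> n +>\<^bsub>O\<^sub>K\<^esub> (a [^]\<^bsub>O\<^sub>K\<^esub> Suc n) = place_power \<pp> n"
    by (subst ideal.a_rcos_eq_self_iff[OF ideal_place_power]) (use a in auto)
  moreover have "place_power \<pp> n +>\<^bsub>O\<^sub>K\<^esub> (a [^]\<^bsub>O\<^sub>K\<^esub> Suc k) = x n" for k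
  proof (induction k)
    case 0
    then show ?case using a xa[OF max.cobounded1] by simp
  next
    case (Suc k)
    have "place_power \<pp> n +>\<^bsub>O\<^sub>K\<^esub> (a [^]\<^bsub>O\<^sub>K\<^esub> Suc (Suc k)) =
        (place_power \<pp> n +>\<^bsub>O\<^sub>K\<^esub> (a [^]\<^bsub>O\<^sub>K\<^esub> Suc k)) \<otimes>\<^bsub>residue_ring_pow \<pp> n\<^esub>
        (place_power \<pp> n +>\<^bsub>O\<^sub>K\<^esub> a)"
      unfolding O.nat_pow_Suc[of a "Suc k"]
      by (rule ring_hom_mult[OF ideal.rcos_ring_hom[OF ideal_place_power]]) (use a in simp_all)
    also have "\<dots> = (x \<otimes>\<^bsub>completion \<pp>\<^esub> x) n"
      by (simp only: Suc completion_simps xa[OF max.cobounded1, symmetric])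
    also have "\<dots> = x n" by (simp only: x(2))
    finally show ?case .
  qed
  ultimately show "x n = \<zero>\<^bsub>completion \<pp>\<^esub> n"
    by (simp add: completion_simps FactRing_def)
qed

text \<open>The residue of \<open>x\<close> is an idempotent of a domain, hence 0 or 1. In the
  second case the complementary idempotent \<open>1 - x\<close> vanishes at level 1 and is therefore
  zero.\<close>

lemma completion_idempotent:
  assumes x: "x \<in> carrier (completion \<pp>)" "x \<otimes>\<^bsub>completion \<pp>\<^esub> x = x"
  shows "x = (if x 1 = \<zero>\<^bsub>residue_ring_pow \<pp> 1\<^esub> then \<zero>\<^bsub>completion \<pp>\<^esub> else \<one>\<^bsub>completion \<pp>\<^esub>)"
proof (cases "x 1 = \<zero>\<^bsub>residue_ring_pow \<pp> 1\<^esub>")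
  case True
  then show ?thesis using completion_idempotent_eq_zero[OF x] by simp
next
  case False
  interpret C: cring "completion \<pp>" by (rule cring_completion)
  interpret D: domain "residue_ring_pow \<pp> 1" by (rule domain_residue_ring)
  have x1: "x 1 \<in> carrier (residue_ring_pow \<pp> 1)" by (rule completion_component[OF x(1)])
  have "x 1 \<otimes>\<^bsub>residue_ring_pow \<pp> 1\<^esub> x 1 = x 1"
    by (simp only: x(2) flip: completion_simps(1))
  then have x1': "x 1 = \<one>\<^bsub>residue_ring_pow \<pp> 1\<^esub>"
    using D.m_lcancel[OF False x1 x1 D.one_closed] D.r_one[OF x1] by metis
  define y where "y = \<one>\<^bsub>completion \<pp>\<^esub> \<ominus>\<^bsub>completion \<pp>\<^esub> x"
  have y: "y \<in> carrier (completion \<pp>)" "y \<oplus>\<^bsub>completion \<pp>\<^esub> x = \<one>\<^bsub>completion \<pp>\<^esub>"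
    using x by (simp_all add: y_def C.minus_eq C.a_assoc C.l_neg)
  have "x \<otimes>\<^bsub>completion \<pp>\<^esub> y = \<zero>\<^bsub>completion \<pp>\<^esub>"
    using x by (simp add: y_def C.minus_eq C.r_distr C.r_minus C.r_neg)
  moreover have "y \<otimes>\<^bsub>completion \<pp>\<^esub> (y \<oplus>\<^bsub>completion \<pp>\<^esub> x) = y" using y by simp
  ultimately have "y \<otimes>\<^bsub>completion \<pp>\<^esub> y = y"
    using x y(1) by (simp add: C.r_distr C.m_comm[of y x])
  moreover have "y 1 = \<zero>\<^bsub>residue_ring_pow \<pp> 1\<^esub>"
  proof -
    have "y 1 \<oplus>\<^bsub>residue_ring_pow \<pp> 1\<^esub> x 1 = \<one>\<^bsub>residue_ring_pow \<pp> 1\<^esub>"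
      by (simp only: y(2) flip: completion_simps(2,3))
    then show ?thesis
      unfolding x1' using completion_component[OF y(1), of 1]
      by (metis D.add.r_cancel_one D.one_closed)
  qed
  ultimately have "y = \<zero>\<^bsub>completion \<pp>\<^esub>" using completion_idempotent_eq_zero y(1) by blast
  then show ?thesis using y(2) False x(1) by simp
qed

text \<open>The powers of the place decrease, so vanishing at any level \<open>n > 0\<close> forces
  vanishing at level 1. At level 0 the quotient is the zero ring, which contributes only
  \<open>0\<close> to the supremum.\<close>

lemma valuation_eq_0_iff:
  assumes x: "x \<in> carrier (completion \<pp>)"
  shows "valuation \<pp> x = 0 \<longleftrightarrow> x 1 \<noteq> \<zero>\<^bsub>residue_ring_pow \<pp> 1\<^esub>"
proof
  assume *: "valuation \<pp> x = 0"
  show "x 1 \<noteq> \<zero>\<^bsub>residue_ring_pow \<pp> 1\<^esub>"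
  proof
    assume "x 1 = \<zero>\<^bsub>residue_ring_pow \<pp> 1\<^esub>"
    then have "enat 1 \<le> valuation \<pp> x"
      unfolding valuation_def by (intro SUP_upper) simp
    then show False by (simp add: * enat_0_iff)
  qed
next
  assume x1: "x 1 \<noteq> \<zero>\<^bsub>residue_ring_pow \<pp> 1\<^esub>"
  have "n = 0" if n: "x n = \<zero>\<^bsub>residue_ring_pow \<pp> n\<^esub>" for n
  proof (rule ccontr)
    assume "n \<noteq> 0"
    then have n1: "1 \<le> n" by simp
    obtain a where a: "a \<in> carrier O\<^sub>K"
      and xa: "\<And>m. m \<le> n \<Longrightarrow> x m = place_power \<pp> m +>\<^bsub>O\<^sub>K\<^esub> a"
      using completion_representative[OF x, of n] by blast
    have "place_power \<pp> n +>\<^bsub>O\<^sub>K\<^esub> a = place_power \<pp> n"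
      using xa[of n] n by (simp add: FactRing_def)
    then have "a \<in> place_power \<pp> n"
      using ideal.a_rcos_eq_self_iff[OF ideal_place_power a] by simp
    then have "a \<in> place_power \<pp> 1"
      using cring.ideal_power_antimono[OF cring_O\<^sub>K ideal_place n1] by blast
    then have "place_power \<pp> 1 +>\<^bsub>O\<^sub>K\<^esub> a = place_power \<pp> 1"
      using ideal.a_rcos_eq_self_iff[OF ideal_place_power a] by simp
    then show False using x1 xa[OF n1] by (simp add: FactRing_def)
  qed
  then have "valuation \<pp> x \<le> 0"
    unfolding valuation_def by (intro SUP_least) (auto simp: enat_0_iff)
  then show "valuation \<pp> x = 0" by simp
qed

text \<open>A unit has nonzero residue and the quotient at level 1 is a domain, so the product
  vanishes there exactly when \<open>x\<close> does.\<close>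

lemma valuation_mult_unit:
  assumes x: "x \<in> carrier (completion \<pp>)" and u: "u \<in> Units (completion \<pp>)"
  shows "valuation \<pp> (x \<otimes>\<^bsub>completion \<pp>\<^esub> u) = 0 \<longleftrightarrow> valuation \<pp> x = 0"
proof -
  interpret C: cring "completion \<pp>" by (rule cring_completion)
  interpret D: domain "residue_ring_pow \<pp> 1" by (rule domain_residue_ring)
  have uc: "u \<in> carrier (completion \<pp>)" using u by (rule C.Units_closed)
  have "u 1 \<otimes>\<^bsub>residue_ring_pow \<pp> 1\<^esub> (inv\<^bsub>completion \<pp>\<^esub> u) 1 = \<one>\<^bsub>residue_ring_pow \<pp> 1\<^esub>"
    by (simp only: C.Units_r_inv[OF u] flip: completion_simps(1,3))
  then have "u 1 \<noteq> \<zero>\<^bsub>residue_ring_pow \<pp> 1\<^esub>"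
    using D.l_null[OF completion_component[OF C.Units_inv_closed[OF u]]] D.one_not_zero by metis
  then show ?thesis
    using x uc completion_component[OF x, of 1] completion_component[OF uc, of 1]
    by (simp add: valuation_eq_0_iff completion_simps D.integral_iff del: One_nat_def)
qed

lemma valuation_one: "valuation \<pp> \<one>\<^bsub>completion \<pp>\<^esub> = 0"
  using domain.one_not_zero[OF domain_residue_ring]
  by (simp add: valuation_eq_0_iff completion_one_zero_closed completion_simps)

lemma valuation_zero: "valuation \<pp> \<zero>\<^bsub>completion \<pp>\<^esub> \<noteq> 0"
  by (simp add: valuation_eq_0_iff completion_one_zero_closed completion_simps)

end

section \<open>The abelian Galois group\<close>

lemma ring_of_type_algebra_simps [simp]:
  "carrier ring_of_type_algebra = UNIV"
  "x \<otimes>\<^bsub>ring_of_type_algebra\<^esub> y = x * y"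
  "x \<oplus>\<^bsub>ring_of_type_algebra\<^esub> y = x + y"
  "\<one>\<^bsub>ring_of_type_algebra\<^esub> = 1"
  "\<zero>\<^bsub>ring_of_type_algebra\<^esub> = 0"
  by (simp_all add: ring_of_type_algebra_def)

lemma a_inv_ring_of_type_algebra [simp]:
  "\<ominus>\<^bsub>ring_of_type_algebra\<^esub> x = - (x :: 'a::comm_ring_1)"
proof -
  interpret cring "ring_of_type_algebra :: 'a ring" ..
  show ?thesis by (rule minus_equality) simp_all
qed

lemma m_inv_ring_of_type_algebra [simp]:
  fixes x :: "'a::field"
  assumes "x \<noteq> 0"
  shows "inv\<^bsub>ring_of_type_algebra\<^esub> x = inverse x"
proof -
  interpret cring "ring_of_type_algebra :: 'a ring" ..
  show ?thesis using assms by (intro comm_inv_char) simp_all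
qed

lemma subfield_ring_of_type_algebra_iff:
  fixes L :: "'a::field set"
  shows "subfield L ring_of_type_algebra \<longleftrightarrow>
    1 \<in> L \<and> (\<forall>x\<in>L. - x \<in> L \<and> inverse x \<in> L) \<and> (\<forall>x\<in>L. \<forall>y\<in>L. x + y \<in> L \<and> x * y \<in> L)"
    (is "?lhs \<longleftrightarrow> ?rhs")
proof
  interpret field "ring_of_type_algebra :: 'a ring" ..
  show ?lhs if ?rhs
    using that by (intro subfieldI' subringI) auto
  show ?rhs if L: ?lhs
  proof -
    note S = subringE[OF subfieldE(1)[OF L]]
    \<comment> \<open>The convention \<open>inverse 0 = 0\<close> makes closure under inverses hold
      at zero as well.\<close>
    have "inverse x \<in> L" if "x \<in> L" for x
      using subfield_m_inv(1)[OF L, of x] that S(2) by (cases "x = 0") auto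
    then show ?thesis using S by auto
  qed
qed

lemma subfield_range_to_ac: "subfield (range to_ac) ring_of_type_algebra"
  unfolding subfield_ring_of_type_algebra_iff
  by (auto simp flip: to_ac_1 to_ac_minus to_ac_inverse to_ac_add to_ac_mult)

section \<open>Automorphism groups over the base field\<close>

lemma in_galois_group_iff:
  "\<sigma> \<in> carrier (galois_group L) \<longleftrightarrow>
    \<sigma> \<in> extensional L \<and> bij_betw \<sigma> L L \<and> \<sigma> 1 = 1 \<and>
    (\<forall>x\<in>L. \<forall>y\<in>L. \<sigma> (x + y) = \<sigma> x + \<sigma> y \<and> \<sigma> (x * y) = \<sigma> x * \<sigma> y) \<and>
    (\<forall>x. \<sigma> (to_ac x) = to_ac x)"
  unfolding galois_group_def Bij_def ring_hom_def
  by (auto dest: bij_betw_apply)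

lemma galois_group_simps:
  "\<one>\<^bsub>galois_group L\<^esub> = (\<lambda>x\<in>L. x)"
  "\<sigma> \<in> carrier (galois_group L) \<Longrightarrow> \<tau> \<in> carrier (galois_group L) \<Longrightarrow>
    \<sigma> \<otimes>\<^bsub>galois_group L\<^esub> \<tau> = compose L \<sigma> \<tau>"
  by (simp_all add: galois_group_def BijGroup_def)

text \<open>The automorphisms form a subgroup of the bijections of \<open>L\<close>. The identity,
  composites and inverses are cut off to \<open>L\<close>, so
  \<open>range to_ac \<subseteq> L\<close> is what lets them fix the base field.\<close>

lemma group_galois_group:
  assumes L: "subfield L ring_of_type_algebra" and K: "range to_ac \<subseteq> L"
  shows "group (galois_group L)"
proof -
  note closed = L[unfolded subfield_ring_of_type_algebra_iff]
  let ?S = "carrier (galois_group L)"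
  have "subgroup ?S (BijGroup L)"
  proof (rule group.subgroupI[OF group_BijGroup])
    show "?S \<subseteq> carrier (BijGroup L)" by (auto simp: galois_group_def BijGroup_def)
    show "?S \<noteq> {}"
    proof -
      have "(\<lambda>x\<in>L. x) \<in> ?S"
        using closed K by (simp add: in_galois_group_iff bij_betw_def inj_on_def subset_iff)
      then show ?thesis by blast
    qed
  next
    fix \<sigma> assume \<sigma>: "\<sigma> \<in> ?S"
    then have \<sigma>': "\<sigma> \<in> Bij L" by (simp add: in_galois_group_iff Bij_def)
    note h = \<sigma>[unfolded in_galois_group_iff]
    have inj: "inj_on \<sigma> L" and surj: "\<sigma> ` L = L" using h by (simp_all add: bij_betw_def)
    have *: "inv_into L \<sigma> (\<sigma> x) = x" if "x \<in> L" for x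
      using inj that by simp
    have "(\<lambda>x\<in>L. inv_into L \<sigma> x) \<in> ?S"
      unfolding in_galois_group_iff
    proof (intro conjI ballI allI)
      show "bij_betw (restrict (inv_into L \<sigma>) L) L L"
        using h by (simp add: bij_betw_inv_into)
      show "restrict (inv_into L \<sigma>) L 1 = 1" using *[of 1] h closed by simp
      show "restrict (inv_into L \<sigma>) L (to_ac x) = to_ac x" for x
        using *[of "to_ac x"] h K by auto
    next
      \<comment> \<open>The inverse map is additive and multiplicative because its arguments can be
        pulled back along the surjection \<open>\<sigma>\<close>.\<close>
      fix x y assume "x \<in> L" "y \<in> L"
      then have "x \<in> \<sigma> ` L" "y \<in> \<sigma> ` L" by (simp_all add: surj)
      then obtain x' y' where xy: "x' \<in> L" "y' \<in> L" "x = \<sigma> x'" "y = \<sigma> y'"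
        by (elim imageE)
      let ?i = "restrict (inv_into L \<sigma>) L"
      have in_L: "x' + y' \<in> L" "x' * y' \<in> L" "x + y \<in> L" "x * y \<in> L"
        using closed xy(1,2) \<open>x \<in> L\<close> \<open>y \<in> L\<close> by auto
      have "x + y = \<sigma> (x' + y')" "x * y = \<sigma> (x' * y')" using xy h by simp_all
      then have "?i (x + y) = x' + y'" "?i (x * y) = x' * y'"
        using in_L *[OF in_L(1)] *[OF in_L(2)] by simp_all
      moreover have "?i x = x'" "?i y = y'"
        using xy(3,4) *[OF xy(1)] *[OF xy(2)] \<open>x \<in> L\<close> \<open>y \<in> L\<close> by simp_all
      ultimately show "?i (x + y) = ?i x + ?i y" "?i (x * y) = ?i x * ?i y"
        by simp_all
    qed simp
    then show "inv\<^bsub>BijGroup L\<^esub> \<sigma> \<in> ?S" by (simp add: inv_BijGroup[OF \<sigma>'])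
  next
    fix \<sigma> \<tau> assume *: "\<sigma> \<in> ?S" "\<tau> \<in> ?S"
    note h = *[unfolded in_galois_group_iff]
    have bij: "bij_betw \<sigma> L L" "bij_betw \<tau> L L" using h by simp_all
    have m: "\<tau> x \<in> L" if "x \<in> L" for x using bij_betw_apply[OF bij(2) that] .
    have c: "compose L \<sigma> \<tau> x = \<sigma> (\<tau> x)" if "x \<in> L" for x
      using that by (simp add: compose_def)
    have "compose L \<sigma> \<tau> \<in> ?S"
      unfolding in_galois_group_iff
    proof (intro conjI ballI allI)
      show "bij_betw (compose L \<sigma> \<tau>) L L"
        using bij_betw_compose[OF bij(2,1)] .
      show "compose L \<sigma> \<tau> 1 = 1" using h closed by (simp add: c)
      show "compose L \<sigma> \<tau> (to_ac x) = to_ac x" for x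
        using h K c[of "to_ac x"] by (simp add: subset_iff)
    next
      fix x y assume xy: "x \<in> L" "y \<in> L"
      then have "x + y \<in> L" "x * y \<in> L" using closed by auto
      then show "compose L \<sigma> \<tau> (x + y) = compose L \<sigma> \<tau> x + compose L \<sigma> \<tau> y"
        "compose L \<sigma> \<tau> (x * y) = compose L \<sigma> \<tau> x * compose L \<sigma> \<tau> y"
        using xy m[OF xy(1)] m[OF xy(2)] h by (simp_all add: c)
    qed simp
    then show "\<sigma> \<otimes>\<^bsub>BijGroup L\<^esub> \<tau> \<in> ?S"
      using * by (simp add: in_galois_group_iff BijGroup_def Bij_def)
  qed
  then have "group (BijGroup L\<lparr>carrier := ?S\<rparr>)"
    by (rule subgroup.subgroup_is_group) (rule group_BijGroup)
  then show ?thesis by (simp add: galois_group_def)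
qed

text \<open>The base field has dimension 1 over itself and the identity as its only automorphism.
  This puts it inside the maximal abelian extension.\<close>

lemma finite_abelian_extension_base:
  "finite_abelian_extension (range to_ac :: 'a::field alg_closure set)"
proof -
  interpret field "ring_of_type_algebra :: 'a alg_closure ring" ..
  let ?K = "range to_ac :: 'a alg_closure set"
  have triv: "\<sigma> = (\<lambda>x\<in>?K. x)" if "\<sigma> \<in> carrier (galois_group ?K)" for \<sigma> :: "'a alg_closure \<Rightarrow> _"
    using that by (auto simp: in_galois_group_iff intro!: extensionalityI[of _ ?K])
  have "finite_dimension ?K ?K"
    using dimension_one[OF subfield_range_to_ac] by (rule finite_dimensionI)
  moreover have "comm_group (galois_group ?K)"
    using group_galois_group[OF subfield_range_to_ac]
    by (rule group.group_comm_groupI) (auto dest!: triv)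
  ultimately show ?thesis
    unfolding finite_abelian_extension_def
    by (auto simp: subfield_range_to_ac dest!: triv)
qed

lemma subfield_max_abelian_extension:
  "subfield (max_abelian_extension :: 'k::field alg_closure set) ring_of_type_algebra"
proof -
  interpret field "ring_of_type_algebra :: 'k alg_closure ring" ..
  show ?thesis unfolding max_abelian_extension_def by (rule generate_field_is_subfield) simp
qed

lemma finite_abelian_extension_subset:
  "finite_abelian_extension L \<Longrightarrow> L \<subseteq> max_abelian_extension"
  unfolding max_abelian_extension_def by (auto intro: generate_field.incl)

section \<open>Stability of finite abelian extensions under automorphisms\<close>

text \<open>Horner's scheme, by induction on \<open>p\<close>: the coefficients are fixed, and sums
  and products are respected. Consequently roots of base-field polynomials go to roots.\<close>

lemma galois_group_poly:
  assumes M: "subfield M ring_of_type_algebra" "range to_ac \<subseteq> M"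
    and \<sigma>: "\<sigma> \<in> carrier (galois_group M)" and x: "x \<in> M"
  shows "poly (map_poly to_ac p) x \<in> M \<and>
    \<sigma> (poly (map_poly to_ac p) x) = poly (map_poly to_ac p) (\<sigma> x)"
proof (induction p)
  case 0
  have "\<sigma> 0 = 0" using \<sigma> unfolding in_galois_group_iff by (metis to_ac_0)
  then show ?case using M(2) by (auto simp flip: to_ac_0)
next
  case (pCons a p)
  have "to_ac a \<in> M" using M(2) by auto
  then show ?case
    using pCons x \<sigma> M(1) unfolding in_galois_group_iff subfield_ring_of_type_algebra_iff
    by (simp add: map_poly_pCons)
qed

text \<open>Coefficients are ring expressions in the roots, so applying \<open>\<sigma>\<close> to
  them amounts to moving each root. It serves to show that a polynomial whose roots are permuted has
  fixed coefficients.\<close>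

lemma galois_group_prod_linear:
  assumes L: "subfield L ring_of_type_algebra" "range to_ac \<subseteq> L"
    and \<sigma>: "\<sigma> \<in> carrier (galois_group L)" and A: "finite A" "A \<subseteq> L"
  shows "Polynomial.coeff (\<Prod>y\<in>A. [:- y, 1:]) i \<in> L \<and>
    \<sigma> (Polynomial.coeff (\<Prod>y\<in>A. [:- y, 1:]) i) = Polynomial.coeff (\<Prod>y\<in>A. [:- \<sigma> y, 1:]) i"
  using A
proof (induction A arbitrary: i)
  case empty
  have "\<sigma> 0 = 0" "\<sigma> 1 = 1" using \<sigma> unfolding in_galois_group_iff by (metis to_ac_0, simp)
  moreover have "0 \<in> L" "1 \<in> L" using L(2) by (auto simp flip: to_ac_0 to_ac_1)
  ultimately show ?case by (auto simp: coeff_1)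
next
  case (insert a A)
  have c: "1 \<in> L" "\<And>x. x \<in> L \<Longrightarrow> - x \<in> L" "\<And>x y. x \<in> L \<Longrightarrow> y \<in> L \<Longrightarrow> x + y \<in> L"
    "\<And>x y. x \<in> L \<Longrightarrow> y \<in> L \<Longrightarrow> x * y \<in> L"
    using L(1) unfolding subfield_ring_of_type_algebra_iff by auto
  have h: "\<sigma> 0 = 0" "\<And>x y. x \<in> L \<Longrightarrow> y \<in> L \<Longrightarrow> \<sigma> (x + y) = \<sigma> x + \<sigma> y"
    "\<And>x y. x \<in> L \<Longrightarrow> y \<in> L \<Longrightarrow> \<sigma> (x * y) = \<sigma> x * \<sigma> y"
    using \<sigma> unfolding in_galois_group_iff by (metis to_ac_0, simp_all)
  have m: "\<sigma> (- x) = - \<sigma> x" if "x \<in> L" for x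
    using h(2)[of x "- x"] c(2)[OF that] that h(1) by (simp add: eq_neg_iff_add_eq_0 add.commute)
  show ?case
  proof -
    let ?P = "\<lambda>i. Polynomial.coeff (\<Prod>y\<in>A. [:- y, 1:]) i"
    have a: "a \<in> L" "- a \<in> L" and P: "?P i \<in> L" for i
      using insert c(2) by auto
    let ?Q = "\<lambda>i. Polynomial.coeff (\<Prod>y\<in>A. [:- \<sigma> y, 1:]) i"
    have PQ: "\<sigma> (?P i) = ?Q i" for i using insert by simp
    \<comment> \<open>The recursion for one more linear factor, stated for a general
      \<open>f\<close> to cover both the identity and \<open>\<sigma>\<close>.\<close>
    have coeff: "Polynomial.coeff (\<Prod>y\<in>insert a A. [:- f y, 1:]) i =
        - f a * Polynomial.coeff (\<Prod>y\<in>A. [:- f y, 1:]) i +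
        (case i of 0 \<Rightarrow> 0 | Suc j \<Rightarrow> Polynomial.coeff (\<Prod>y\<in>A. [:- f y, 1:]) j)" for f
      using insert(1,2) by (simp add: coeff_pCons split: nat.split)
    have u: "- a * ?P i \<in> L" "\<sigma> (- a * ?P i) = - \<sigma> a * ?Q i"
      using c(4)[OF a(2) P] h(3)[OF a(2) P] m[OF a(1)] PQ by simp_all
    have "0 \<in> L" using L(2) by (auto simp flip: to_ac_0)
    then have v: "(case i of 0 \<Rightarrow> 0 | Suc j \<Rightarrow> ?P j) \<in> L"
      "\<sigma> (case i of 0 \<Rightarrow> 0 | Suc j \<Rightarrow> ?P j) = (case i of 0 \<Rightarrow> 0 | Suc j \<Rightarrow> ?Q j)"
      using P PQ h(1) by (simp_all split: nat.split)
    show ?thesis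
      unfolding coeff[of "\<lambda>y. y"] coeff[of \<sigma>] h(2)[OF u(1) v(1)] u(2) v(2)
      using c(3)[OF u(1) v(1)] by simp
  qed
qed

text \<open>The orbit of \<open>x\<close> under the Galois group of \<open>L\<close> is the root set of a polynomial over the
  base field, so it is stable under every automorphism of a larger field.\<close>

lemma galois_group_finite_abelian_extension_closed:
  assumes L: "finite_abelian_extension L" "L \<subseteq> M"
    and M: "subfield M ring_of_type_algebra"
    and \<sigma>: "\<sigma> \<in> carrier (galois_group M)" and x: "x \<in> L"
  shows "\<sigma> x \<in> L"
proof -
  let ?G = "carrier (galois_group L)"
  have L': "subfield L ring_of_type_algebra" "range to_ac \<subseteq> L"
    and fixed: "{x \<in> L. \<forall>\<sigma> \<in> ?G. \<sigma> x = x} = range to_ac"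
    using L(1) by (auto simp: finite_abelian_extension_def)
  have KM: "range to_ac \<subseteq> M" using L'(2) L(2) by auto
  interpret G: group "galois_group L" by (rule group_galois_group[OF L'])
  define \<Omega> where "\<Omega> = (\<lambda>g. g x) ` ?G"
  \<comment> \<open>Algebraicity gives a base-field polynomial with root \<open>x\<close>; the orbit
    lies among its finitely many roots.\<close>
  obtain p where p: "p \<noteq> 0" "poly (map_poly to_ac p) x = 0"
    by (rule alg_closure_algebraic)
  have "\<Omega> \<subseteq> {y. poly (map_poly to_ac p) y = 0}"
  proof (clarsimp simp: \<Omega>_def)
    fix g assume g: "g \<in> ?G"
    have "g 0 = 0" using g unfolding in_galois_group_iff by (metis to_ac_0)
    then show "poly (map_poly to_ac p) (g x) = 0"
      using galois_group_poly[OF L' g x, of p] p(2) by simp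
  qed
  moreover have "map_poly to_ac p \<noteq> 0"
    using p(1) by (auto simp: poly_eq_iff coeff_map_poly)
  ultimately have fin: "finite \<Omega>"
    by (metis poly_roots_finite finite_subset)
  have \<Omega>L: "\<Omega> \<subseteq> L"
    using x by (auto simp: \<Omega>_def in_galois_group_iff dest: bij_betw_apply)
  have "\<one>\<^bsub>galois_group L\<^esub> x \<in> \<Omega>"
    unfolding \<Omega>_def by (intro imageI G.one_closed)
  then have x\<Omega>: "x \<in> \<Omega>"
    using x by (simp add: galois_group_simps)
  define P where "P = (\<Prod>y\<in>\<Omega>. [:- y, 1:])"
  have "Polynomial.coeff P i \<in> range to_ac" for i
  proof -
    have "g (Polynomial.coeff P i) = Polynomial.coeff P i" if g: "g \<in> ?G" for g
    proof -
      have inj: "inj_on g \<Omega>"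
        using g \<Omega>L by (auto simp: in_galois_group_iff bij_betw_def intro: inj_on_subset)
      have "g ` \<Omega> \<subseteq> \<Omega>"
      proof (clarsimp simp: \<Omega>_def)
        fix h assume h: "h \<in> ?G"
        have "g (h x) = (g \<otimes>\<^bsub>galois_group L\<^esub> h) x"
          using g h x by (simp add: galois_group_simps compose_def)
        moreover have "(g \<otimes>\<^bsub>galois_group L\<^esub> h) x \<in> (\<lambda>g. g x) ` ?G"
          by (intro imageI G.m_closed g h)
        ultimately show "g (h x) \<in> (\<lambda>g. g x) ` ?G" by simp
      qed
      \<comment> \<open>An injective self-map of a finite set permutes it, so \<open>g\<close> only
        reorders the factors of \<open>P\<close>.\<close>
      then have "bij_betw g \<Omega> \<Omega>"
        using inj fin by (simp add: bij_betw_def endo_inj_surj)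
      then have "(\<Prod>y\<in>\<Omega>. [:- g y, 1:]) = P"
        unfolding P_def by (rule prod.reindex_bij_betw)
      then show ?thesis
        using galois_group_prod_linear[OF L' g fin \<Omega>L, of i] by (simp add: P_def)
    qed
    moreover have "Polynomial.coeff P i \<in> L"
      using galois_group_prod_linear[OF L' G.one_closed fin \<Omega>L, of i] by (simp add: P_def)
    \<comment> \<open>The fixed field of the group is the base field, as the definition of a finite
      abelian extension demands.\<close>
    ultimately have "Polynomial.coeff P i \<in> {x \<in> L. \<forall>\<sigma> \<in> ?G. \<sigma> x = x}" by simp
    then show ?thesis by (simp only: fixed)
  qed
  \<comment> \<open>\<open>P\<close> descends to the base field, the form that
    \<open>galois_group_poly\<close> accepts for the automorphism \<open>\<sigma>\<close> of
    \<open>M\<close>.\<close>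
  then have P: "map_poly to_ac (map_poly of_ac P) = P"
    by (intro poly_eqI) (simp add: coeff_map_poly to_ac_of_ac)
  have root: "poly P y = 0 \<longleftrightarrow> y \<in> \<Omega>" for y
    using fin by (auto simp: P_def poly_prod)
  have "\<sigma> 0 = 0" using \<sigma> unfolding in_galois_group_iff by (metis to_ac_0)
  then have "poly P (\<sigma> x) = 0"
    using galois_group_poly[OF M KM \<sigma>, of x "map_poly of_ac P"] x L(2) x\<Omega> root[of x]
    unfolding P by auto
  then show ?thesis using root \<Omega>L by auto
qed

text \<open>Stability of \<open>L\<close> under \<open>\<sigma>\<close> gives a map into
  \<open>L\<close>; stability under the inverse automorphism provides preimages in
  \<open>L\<close>.\<close>

lemma restrict_galois_group:
  assumes L: "finite_abelian_extension L" "L \<subseteq> M"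
    and M: "subfield M ring_of_type_algebra"
    and \<sigma>: "\<sigma> \<in> carrier (galois_group M)"
  shows "restrict \<sigma> L \<in> carrier (galois_group L)"
proof -
  have L': "subfield L ring_of_type_algebra" "range to_ac \<subseteq> L"
    using L(1) by (auto simp: finite_abelian_extension_def)
  have KM: "range to_ac \<subseteq> M" using L'(2) L(2) by auto
  interpret G: group "galois_group M" by (rule group_galois_group[OF M KM])
  note closed = galois_group_finite_abelian_extension_closed[OF L M]
  have "y \<in> \<sigma> ` L" if y: "y \<in> L" for y
  proof -
    have "\<sigma> ((inv\<^bsub>galois_group M\<^esub> \<sigma>) y) = (\<sigma> \<otimes>\<^bsub>galois_group M\<^esub> inv\<^bsub>galois_group M\<^esub> \<sigma>) y"
      using \<sigma> y L(2) by (auto simp: galois_group_simps(2) compose_def)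
    also have "\<dots> = y" unfolding G.r_inv[OF \<sigma>] using y L(2) by (auto simp: galois_group_simps)
    finally show ?thesis using closed[OF G.inv_closed[OF \<sigma>] y] by (metis image_eqI)
  qed
  moreover have "inj_on \<sigma> L"
    using \<sigma> L(2) by (auto simp: in_galois_group_iff bij_betw_def intro: inj_on_subset)
  ultimately have "bij_betw \<sigma> L L"
    using closed[OF \<sigma>] by (auto simp: bij_betw_def)
  moreover have "x \<in> M" if "x \<in> L" for x using that L(2) by blast
  ultimately show ?thesis
    using \<sigma> L' unfolding in_galois_group_iff subfield_ring_of_type_algebra_iff by auto
qed

text \<open>The elements on which the two composites agree form a subfield. It contains each finite
  abelian extension, hence the field that these generate.\<close>

lemma comm_group_abelian_galois_group:
  "comm_group (abelian_galois_group :: ('k::field alg_closure \<Rightarrow> 'k alg_closure) monoid)"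
proof -
  let ?M = "max_abelian_extension :: 'k alg_closure set"
  interpret F: field "ring_of_type_algebra :: 'k alg_closure ring" ..
  note M = subfield_max_abelian_extension
  have KM: "range to_ac \<subseteq> ?M"
    by (rule finite_abelian_extension_subset[OF finite_abelian_extension_base])
  interpret G: group "galois_group ?M" by (rule group_galois_group[OF M KM])
  have "\<sigma> \<otimes>\<^bsub>galois_group ?M\<^esub> \<tau> = \<tau> \<otimes>\<^bsub>galois_group ?M\<^esub> \<sigma>"
    if \<sigma>\<tau>: "\<sigma> \<in> carrier (galois_group ?M)" "\<tau> \<in> carrier (galois_group ?M)" for \<sigma> \<tau>
  proof -
    note \<alpha> = G.m_closed[OF \<sigma>\<tau>] and \<beta> = G.m_closed[OF \<sigma>\<tau>(2,1)]
    define \<alpha> where "\<alpha> = \<sigma> \<otimes>\<^bsub>galois_group ?M\<^esub> \<tau>"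
    define \<beta> where "\<beta> = \<tau> \<otimes>\<^bsub>galois_group ?M\<^esub> \<sigma>"
    define E where "E = {x \<in> ?M. \<alpha> x = \<beta> x}"
    have "L \<subseteq> E" if L: "finite_abelian_extension L" for L
    proof
      fix x assume x: "x \<in> L"
      note LM = finite_abelian_extension_subset[OF L]
      interpret GL: comm_group "galois_group L"
        using L by (simp add: finite_abelian_extension_def)
      note res = restrict_galois_group[OF L LM M] and
        closed = galois_group_finite_abelian_extension_closed[OF L LM M]
      \<comment> \<open>The restrictions commute in the abelian group of \<open>L\<close>; stability
        of \<open>L\<close> then allows the restrictions to be removed.\<close>
      have "(restrict \<sigma> L \<otimes>\<^bsub>galois_group L\<^esub> restrict \<tau> L) x =
          (restrict \<tau> L \<otimes>\<^bsub>galois_group L\<^esub> restrict \<sigma> L) x"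
        by (simp add: GL.m_comm res \<sigma>\<tau>)
      then have "\<sigma> (\<tau> x) = \<tau> (\<sigma> x)"
        using x \<sigma>\<tau> by (simp add: galois_group_simps res compose_def closed)
      then show "x \<in> E"
        using x LM \<sigma>\<tau> by (auto simp: E_def \<alpha>_def \<beta>_def galois_group_simps compose_def)
    qed
    moreover have "subfield E ring_of_type_algebra"
    proof -
      \<comment> \<open>Field homomorphisms respect negatives and inverses, so \<open>E\<close> is
        closed under both.\<close>
      have mh: "\<gamma> (- x) = - \<gamma> x" and ih: "\<gamma> (inverse x) = inverse (\<gamma> x)"
        if \<gamma>: "\<gamma> \<in> carrier (galois_group ?M)" and x: "x \<in> ?M" for \<gamma> x
      proof -
        note h = \<gamma>[unfolded in_galois_group_iff]
        note c = M[unfolded subfield_ring_of_type_algebra_iff]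
        have 0: "\<gamma> 0 = 0" using h by (metis to_ac_0)
        have "\<gamma> (x + - x) = \<gamma> x + \<gamma> (- x)" using h c x by blast
        then show "\<gamma> (- x) = - \<gamma> x" using 0 by (simp add: eq_neg_iff_add_eq_0 add.commute)
        show "\<gamma> (inverse x) = inverse (\<gamma> x)"
        proof (cases "x = 0")
          case False
          have "\<gamma> (x * inverse x) = \<gamma> x * \<gamma> (inverse x)" using h c x by blast
          then have "\<gamma> x * \<gamma> (inverse x) = 1" using False h by simp
          then show ?thesis by (metis inverse_unique)
        qed (simp add: 0)
      qed
      show ?thesis
        using M \<alpha> \<beta> mh[OF \<alpha>] mh[OF \<beta>] ih[OF \<alpha>] ih[OF \<beta>]
        unfolding subfield_ring_of_type_algebra_iff E_def in_galois_group_iff \<alpha>_def \<beta>_def by auto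
    qed
    ultimately have "?M \<subseteq> E"
      unfolding max_abelian_extension_def
      by (intro F.generate_field_min_subfield1) auto
    \<comment> \<open>Both functions take the default value outside \<open>?M\<close>, so agreement
      on \<open>?M\<close> makes them equal.\<close>
    moreover have "\<alpha> \<in> extensional ?M" "\<beta> \<in> extensional ?M"
      using \<alpha> \<beta> by (simp_all add: \<alpha>_def \<beta>_def in_galois_group_iff)
    ultimately show ?thesis
      unfolding \<alpha>_def[symmetric] \<beta>_def[symmetric] E_def
      by (intro extensionalityI[of _ ?M]) auto
  qed
  then show ?thesis unfolding abelian_galois_group_def by (rule G.group_comm_groupI)
qed

section \<open>The Deligne--Ribet monoid\<close>

lemma comm_monoid_product_group:
  assumes "\<And>i. i \<in> I \<Longrightarrow> comm_monoid (G i)"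
  shows "comm_monoid (product_group I G)"
proof (rule comm_monoidI)
  have M: "monoid (G i)" if "i \<in> I" for i
    using assms[OF that] by (rule comm_monoid.axioms)
  fix x y z
  assume x: "x \<in> carrier (product_group I G)"
  then have x': "\<And>i. i \<in> I \<Longrightarrow> x i \<in> carrier (G i)" by auto
  show "\<one>\<^bsub>product_group I G\<^esub> \<otimes>\<^bsub>product_group I G\<^esub> x = x"
    using x by (intro extensionalityI[of _ I]) (auto simp: PiE_def monoid.l_one[OF M x'])
  assume "y \<in> carrier (product_group I G)"
  then have y': "\<And>i. i \<in> I \<Longrightarrow> y i \<in> carrier (G i)" by auto
  show "x \<otimes>\<^bsub>product_group I G\<^esub> y \<in> carrier (product_group I G)"
    by (auto simp: monoid.m_closed[OF M x' y'])
  show "x \<otimes>\<^bsub>product_group I G\<^esub> y = y \<otimes>\<^bsub>product_group I G\<^esub> x"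
    by (auto simp: comm_monoid.m_comm[OF assms x' y'] intro!: restrict_ext)
  assume "z \<in> carrier (product_group I G)"
  then have z': "\<And>i. i \<in> I \<Longrightarrow> z i \<in> carrier (G i)" by auto
  show "x \<otimes>\<^bsub>product_group I G\<^esub> y \<otimes>\<^bsub>product_group I G\<^esub> z =
      x \<otimes>\<^bsub>product_group I G\<^esub> (y \<otimes>\<^bsub>product_group I G\<^esub> z)"
    by (auto simp: monoid.m_assoc[OF M x' y' z'] intro!: restrict_ext)
next
  show "\<one>\<^bsub>product_group I G\<^esub> \<in> carrier (product_group I G)"
    using assms by (auto intro: monoid.one_closed comm_monoid.axioms)
qed

lemma Units_product_group:
  assumes u: "u \<in> Units (product_group I G)" and i: "i \<in> I"
  shows "u i \<in> Units (G i)"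
proof -
  obtain v where v: "v \<in> carrier (product_group I G)"
    "v \<otimes>\<^bsub>product_group I G\<^esub> u = \<one>\<^bsub>product_group I G\<^esub>"
    "u \<otimes>\<^bsub>product_group I G\<^esub> v = \<one>\<^bsub>product_group I G\<^esub>"
    using u unfolding Units_def by blast
  have "v i \<otimes>\<^bsub>G i\<^esub> u i = \<one>\<^bsub>G i\<^esub>" "u i \<otimes>\<^bsub>G i\<^esub> v i = \<one>\<^bsub>G i\<^esub>"
    using v(2,3)[THEN fun_cong, of i] i by simp_all
  moreover have "u i \<in> carrier (G i)" "v i \<in> carrier (G i)"
    using u v(1) i by (auto simp: Units_def)
  ultimately show ?thesis unfolding Units_def by blast
qed

lemma comm_monoid_profinite_integers: "comm_monoid profinite_integers"
  unfolding profinite_integers_def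
  by (intro comm_monoid_product_group cring.axioms(2)[OF cring_completion])

lemma profinite_integers_component:
  "x \<in> carrier profinite_integers \<Longrightarrow> \<pp> \<in> P\<^sub>K \<Longrightarrow> x \<pp> \<in> carrier (completion \<pp>)"
  by (auto simp: profinite_integers_def)

lemma profinite_integers_mult:
  "\<pp> \<in> P\<^sub>K \<Longrightarrow> (x \<otimes>\<^bsub>profinite_integers\<^esub> y) \<pp> = x \<pp> \<otimes>\<^bsub>completion \<pp>\<^esub> y \<pp>"
  by (simp add: profinite_integers_def)

lemma profinite_integers_unit_component:
  "u \<in> Units profinite_integers \<Longrightarrow> \<pp> \<in> P\<^sub>K \<Longrightarrow> u \<pp> \<in> Units (completion \<pp>)"
  unfolding profinite_integers_def by (rule Units_product_group)

section \<open>Unit ideles and reciprocity\<close>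

text \<open>Every component is the image of a local unit, so the exceptional set is empty.\<close>

lemma unit_idele_closed:
  assumes u: "u \<in> Units profinite_integers"
  shows "unit_idele u \<in> carrier finite_ideles"
proof -
  have "to_local_field \<pp> (u \<pp>) \<in> Units (local_field \<pp>)" if "\<pp> \<in> P\<^sub>K" for \<pp>
    unfolding to_local_field_def local_field_def
    by (rule cring.fraction_one_in_Units[OF cring_completion[OF that]
          profinite_integers_unit_component[OF u that]])
  moreover have "{\<pp> \<in> P\<^sub>K. unit_idele u \<pp> \<notin> to_local_field \<pp> ` Units (completion \<pp>)} = {}"
    using profinite_integers_unit_component[OF u] by (auto simp: unit_idele_def)
  ultimately show ?thesis
    unfolding finite_ideles_def by (simp add: unit_idele_def)
qed

lemma unit_idele_mult:
  assumes "u \<in> Units profinite_integers" "v \<in> Units profinite_integers"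
  shows "unit_idele (u \<otimes>\<^bsub>profinite_integers\<^esub> v) = unit_idele u \<otimes>\<^bsub>finite_ideles\<^esub> unit_idele v"
proof -
  have "to_local_field \<pp> (u \<pp> \<otimes>\<^bsub>completion \<pp>\<^esub> v \<pp>) =
      to_local_field \<pp> (u \<pp>) \<otimes>\<^bsub>local_field \<pp>\<^esub> to_local_field \<pp> (v \<pp>)" if \<pp>: "\<pp> \<in> P\<^sub>K" for \<pp>
  proof -
    interpret C: cring "completion \<pp>" by (rule cring_completion[OF \<pp>])
    have "u \<pp> \<in> carrier (completion \<pp>)" "v \<pp> \<in> carrier (completion \<pp>)"
      using assms[THEN profinite_integers_unit_component, OF \<pp>] by (simp_all add: C.Units_closed)
    then show ?thesis
      unfolding to_local_field_def local_field_def
      by (simp add: C.fraction_mult C.one_regular)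
  qed
  then show ?thesis
    unfolding unit_idele_def finite_ideles_def
    by (auto simp: units_of_mult profinite_integers_mult intro!: restrict_ext)
qed

lemma one_archimedean_ideles:
  "\<one>\<^bsub>archimedean_ideles\<^esub> \<in> carrier archimedean_ideles"
  "\<one>\<^bsub>archimedean_ideles\<^esub> \<otimes>\<^bsub>archimedean_ideles\<^esub> \<one>\<^bsub>archimedean_ideles\<^esub> = \<one>\<^bsub>archimedean_ideles\<^esub>"
proof -
  \<comment> \<open>Conjugates of embeddings are embeddings, so the restricted constant family takes
    the value 1 at them and not a default value.\<close>
  have "cnj \<circ> \<sigma> \<in> complex_embeddings" if "\<sigma> \<in> complex_embeddings" for \<sigma> :: "'k::number_field \<Rightarrow> complex"
    using that unfolding complex_embeddings_def ring_hom_def by simp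
  then show "\<one>\<^bsub>archimedean_ideles\<^esub> \<in> carrier (archimedean_ideles :: 'k::number_field archimedean_idele monoid)"
    by (auto simp: archimedean_ideles_def units_of_one)
  show "\<one>\<^bsub>archimedean_ideles\<^esub> \<otimes>\<^bsub>archimedean_ideles\<^esub> \<one>\<^bsub>archimedean_ideles\<^esub> =
      \<one>\<^bsub>archimedean_ideles :: 'k::number_field archimedean_idele monoid\<^esub>"
    by (auto simp: archimedean_ideles_def units_of_one units_of_mult intro!: restrict_ext)
qed

text \<open>Pairing \<open>unit_idele u\<close> with the archimedean identity is multiplicative, and
  \<open>\<theta>\<close> is a homomorphism on ideles. This provides \<open>r_hom\<close> for
  \<open>balanced_product\<close>.\<close>

lemma finite_reciprocity_map_hom:
  assumes "artin_reciprocity_map \<theta>"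
  shows "(\<lambda>u. finite_reciprocity_map \<theta> (unit_idele u)) \<in> hom (units_of profinite_integers) abelian_galois_group"
proof (rule homI; unfold units_of_carrier units_of_mult)
  have \<theta>: "\<theta> \<in> hom ideles abelian_galois_group"
    using assms by (simp add: artin_reciprocity_map_def)
  have closed: "(unit_idele u, \<one>\<^bsub>archimedean_ideles\<^esub>) \<in> carrier ideles"
    if "u \<in> Units profinite_integers" for u :: "'a set \<Rightarrow> 'a local_integer"
    using that by (simp add: ideles_def unit_idele_closed one_archimedean_ideles)
  fix u v :: "'a set \<Rightarrow> 'a local_integer"
  assume u: "u \<in> Units profinite_integers"
  show "finite_reciprocity_map \<theta> (unit_idele u) \<in> carrier abelian_galois_group"
    unfolding finite_reciprocity_map_def by (rule hom_in_carrier[OF \<theta> closed[OF u]])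
  assume v: "v \<in> Units profinite_integers"
  have "(unit_idele (u \<otimes>\<^bsub>profinite_integers\<^esub> v), \<one>\<^bsub>archimedean_ideles\<^esub>) =
      (unit_idele u, \<one>\<^bsub>archimedean_ideles\<^esub>) \<otimes>\<^bsub>ideles\<^esub> (unit_idele v, \<one>\<^bsub>archimedean_ideles\<^esub>)"
    using u v by (simp add: ideles_def unit_idele_mult one_archimedean_ideles)
  then show "finite_reciprocity_map \<theta> (unit_idele (u \<otimes>\<^bsub>profinite_integers\<^esub> v)) =
      finite_reciprocity_map \<theta> (unit_idele u) \<otimes>\<^bsub>abelian_galois_group\<^esub>
      finite_reciprocity_map \<theta> (unit_idele v)"
    unfolding finite_reciprocity_map_def by (simp add: hom_mult[OF \<theta> closed[OF u] closed[OF v]])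
qed

section \<open>Idempotents of the profinite integers\<close>

lemma indicator_integer_closed: "indicator_integer S \<in> carrier profinite_integers"
  by (auto simp: indicator_integer_def profinite_integers_def completion_one_zero_closed)

lemma indicator_integer_idempotent:
  fixes S :: "'k::number_field set set"
  shows "indicator_integer S \<otimes>\<^bsub>profinite_integers\<^esub> indicator_integer S = indicator_integer S"
proof -
  have "x \<otimes>\<^bsub>completion \<pp>\<^esub> x = x"
    if "\<pp> \<in> P\<^sub>K" "x = \<one>\<^bsub>completion \<pp>\<^esub> \<or> x = \<zero>\<^bsub>completion \<pp>\<^esub>"
    for \<pp> :: "'k set" and x
  proof -
    interpret cring "completion \<pp>" by (rule cring_completion[OF that(1)])
    show ?thesis using that(2) by auto
  qed
  then show ?thesis
    unfolding indicator_integer_def profinite_integers_def by (auto intro!: restrict_ext)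
qed

text \<open>The set attached to an idempotent class, as a function of the first coordinate of a
  representative.\<close>

definition unit_places :: "('k::number_field set \<Rightarrow> 'k local_integer) \<Rightarrow> 'k set set" where
  "unit_places \<rho> = {\<pp> \<in> P\<^sub>K. valuation \<pp> (\<rho> \<pp>) = 0}"

text \<open>Recovers \<open>S\<close> from its indicator, the source of uniqueness.\<close>

lemma unit_places_indicator_integer:
  assumes "S \<subseteq> P\<^sub>K"
  shows "unit_places (indicator_integer S) = S"
  using assms by (auto simp: unit_places_def indicator_integer_def valuation_one valuation_zero)

text \<open>Makes the set an invariant of the class, since representatives differ in the first
  coordinate by a unit factor.\<close>

lemma unit_places_mult_unit:
  assumes "\<rho> \<in> carrier profinite_integers" "u \<in> Units profinite_integers"
  shows "unit_places (\<rho> \<otimes>\<^bsub>profinite_integers\<^esub> u) = unit_places \<rho>"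
  using valuation_mult_unit[OF _ profinite_integers_component[OF assms(1)]
      profinite_integers_unit_component[OF assms(2)]]
  by (auto simp: unit_places_def profinite_integers_mult)

text \<open>Each component is idempotent, hence 0 or 1; which of the two occurs is read off from the
  residue at level 1, that is, from whether the valuation is zero.\<close>

lemma profinite_integers_idempotent:
  assumes \<epsilon>: "\<epsilon> \<in> carrier profinite_integers" "\<epsilon> \<otimes>\<^bsub>profinite_integers\<^esub> \<epsilon> = \<epsilon>"
  shows "\<epsilon> = indicator_integer (unit_places \<epsilon>)"
proof (rule extensionalityI[of _ "P\<^sub>K"])
  show "\<epsilon> \<in> extensional P\<^sub>K" using \<epsilon>(1) by (simp add: profinite_integers_def PiE_def)
  show "indicator_integer (unit_places \<epsilon>) \<in> extensional P\<^sub>K" by (simp add: indicator_integer_def)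
  fix \<pp> :: "'a set" assume \<pp>: "\<pp> \<in> P\<^sub>K"
  have "\<epsilon> \<pp> \<otimes>\<^bsub>completion \<pp>\<^esub> \<epsilon> \<pp> = \<epsilon> \<pp>"
    by (simp only: \<epsilon>(2) flip: profinite_integers_mult[OF \<pp>])
  from completion_idempotent[OF \<pp> profinite_integers_component[OF \<epsilon>(1) \<pp>] this]
  show "\<epsilon> \<pp> = indicator_integer (unit_places \<epsilon>) \<pp>"
    using \<pp> by (simp add: indicator_integer_def unit_places_def
        valuation_eq_0_iff[OF \<pp> profinite_integers_component[OF \<epsilon>(1) \<pp>]] split: if_splits)
qed

theorem proposition1p1:
  fixes \<theta> :: "'k::number_field idele \<Rightarrow> ('k alg_closure \<Rightarrow> 'k alg_closure)"
    and rec :: "'k finite_idele \<Rightarrow> ('k alg_closure \<Rightarrow> 'k alg_closure)"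
  assumes "artin_reciprocity_map \<theta>" and "rec = finite_reciprocity_map \<theta>"
  shows "(\<forall>S. S \<subseteq> P\<^sub>K \<longrightarrow>
           standard_idempotent rec S \<in> idempotent_elements (deligne_ribet_monoid rec)) \<and>
    (\<forall>e \<in> idempotent_elements (deligne_ribet_monoid rec).
       (\<exists>!S. S \<subseteq> P\<^sub>K \<and> e = standard_idempotent rec S) \<and>
       (\<forall>\<rho> \<in> carrier profinite_integers. \<forall>s \<in> carrier abelian_galois_group.
          e = deligne_ribet_class rec \<rho> s \<longrightarrow>
          e = standard_idempotent rec {\<pp> \<in> P\<^sub>K. valuation \<pp> (\<rho> \<pp>) = 0}))"
proof -
  let ?M = "profinite_integers :: ('k set \<Rightarrow> 'k local_integer) monoid"
  let ?G = "abelian_galois_group :: ('k alg_closure \<Rightarrow> 'k alg_closure) monoid"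
  let ?D = "deligne_ribet_monoid rec"
  \<comment> \<open>Classes, their products and the passage to an idempotent representative now come
    from the abstract setting.\<close>
  interpret D: balanced_product ?M ?G "\<lambda>u. rec (unit_idele u)"
    unfolding assms(2)
    by (intro balanced_product.intro balanced_product_axioms.intro comm_monoid_profinite_integers
        comm_group_abelian_galois_group finite_reciprocity_map_hom assms(1))
  have rel: "deligne_ribet_rel rec = D.rel"
    by (simp add: deligne_ribet_rel_def D.rel_def)
  have cls: "deligne_ribet_class rec \<rho> s = D.rel `` {(\<rho>, s)}" for \<rho> s
    by (simp add: deligne_ribet_class_def rel)
  have std: "standard_idempotent rec S = D.rel `` {(indicator_integer S, \<one>\<^bsub>?G\<^esub>)}" for S
    by (simp add: standard_idempotent_def cls)
  have carrier_D: "carrier ?D = carrier (?M \<times>\<times> ?G) // D.rel"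
    by (simp add: deligne_ribet_monoid_def rel)
  have mult_D: "(D.rel `` {(\<rho>, s)}) \<otimes>\<^bsub>?D\<^esub> (D.rel `` {(\<rho>, s)}) =
      D.rel `` {(\<rho> \<otimes>\<^bsub>?M\<^esub> \<rho>, s \<otimes>\<^bsub>?G\<^esub> s)}"
    if "\<rho> \<in> carrier ?M" "s \<in> carrier ?G" for \<rho> s
    using D.class_mult[OF that that] by (simp add: deligne_ribet_monoid_def rel)
  \<comment> \<open>Starting from an arbitrary representative yields existence and the explicit
    formula together.\<close>
  have idem: "D.rel `` {(\<rho>, s)} = standard_idempotent rec (unit_places \<rho>)"
    if \<rho>s: "\<rho> \<in> carrier ?M" "s \<in> carrier ?G"
      and e: "D.rel `` {(\<rho>, s)} \<in> idempotent_elements ?D" for \<rho> s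
  proof -
    have "D.rel `` {(\<rho> \<otimes>\<^bsub>?M\<^esub> \<rho>, s \<otimes>\<^bsub>?G\<^esub> s)} = D.rel `` {(\<rho>, s)}"
      using e mult_D[OF \<rho>s] by (simp add: idempotent_elements_def)
    from D.idempotent_class[OF \<rho>s this] obtain u where u: "u \<in> Units ?M"
      "(\<rho> \<otimes>\<^bsub>?M\<^esub> u) \<otimes>\<^bsub>?M\<^esub> (\<rho> \<otimes>\<^bsub>?M\<^esub> u) = \<rho> \<otimes>\<^bsub>?M\<^esub> u"
      "D.rel `` {(\<rho>, s)} = D.rel `` {(\<rho> \<otimes>\<^bsub>?M\<^esub> u, \<one>\<^bsub>?G\<^esub>)}" .
    \<comment> \<open>The set is first that of \<open>\<rho> u\<close>; invariance under units turns
      it into that of \<open>\<rho>\<close>.\<close>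
    have "\<rho> \<otimes>\<^bsub>?M\<^esub> u = indicator_integer (unit_places (\<rho> \<otimes>\<^bsub>?M\<^esub> u))"
      using \<rho>s(1) u by (intro profinite_integers_idempotent) (simp_all add: D.M.Units_closed)
    then show ?thesis
      using u(3) by (simp add: std unit_places_mult_unit[OF \<rho>s(1) u(1)])
  qed
  have closed: "standard_idempotent rec S \<in> idempotent_elements ?D" for S
    using mult_D[OF indicator_integer_closed[of S] D.G.one_closed]
    by (simp add: idempotent_elements_def carrier_D std indicator_integer_idempotent
        quotientI indicator_integer_closed)
  \<comment> \<open>Representatives of equal classes differ by a unit, which leaves the places of
    valuation zero unchanged; for the indicators these are \<open>S\<close> and
    \<open>T\<close>.\<close>
  have inj: "S = T" if ST: "S \<subseteq> P\<^sub>K" "T \<subseteq> P\<^sub>K"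
    and eq: "standard_idempotent rec S = standard_idempotent rec T" for S T
  proof -
    obtain u where "u \<in> Units ?M" "indicator_integer T = indicator_integer S \<otimes>\<^bsub>?M\<^esub> u"
      using eq unfolding std
      by (subst (asm) D.class_eq_iff) (auto simp: indicator_integer_closed)
    then have "unit_places (indicator_integer T) = unit_places (indicator_integer S)"
      using unit_places_mult_unit[OF indicator_integer_closed] by simp
    then show ?thesis using ST by (simp add: unit_places_indicator_integer)
  qed
  have ex: "\<exists>!S. S \<subseteq> P\<^sub>K \<and> e = standard_idempotent rec S" if e: "e \<in> idempotent_elements ?D" for e
  proof -
    have "e \<in> carrier (?M \<times>\<times> ?G) // D.rel"
      using e by (simp add: idempotent_elements_def carrier_D)
    then obtain \<rho> s where "\<rho> \<in> carrier ?M" "s \<in> carrier ?G" "e = D.rel `` {(\<rho>, s)}"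
      by (auto elim!: quotientE)
    then have "e = standard_idempotent rec (unit_places \<rho>)" using idem e by blast
    moreover have "unit_places \<rho> \<subseteq> P\<^sub>K" by (auto simp: unit_places_def)
    ultimately show ?thesis using inj by (intro ex1I[of _ "unit_places \<rho>"]) auto
  qed
  show ?thesis
    \<comment> \<open>Folding \<open>unit_places\<close> matches the explicit set in the
      statement.\<close>
    using closed ex idem by (auto simp: cls simp flip: unit_places_def)
qed

end
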